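(* Let $G$ be a computable topological group. Then $G$ admits a compatible left-invariant metric $d$ which is right-c.e., i.e. there is an enumeration operator $\Phi$ such that for all $y,z\in G$ and any enumerations $p,q$ of the names $N^y,N^z$, $\Phi(p\oplus q)$ enumerates the right cut $\{r\in\mathbb{Q}: d(y,z)<r\}$.
   Context: All spaces and groups are Hausdorff and second countable. A computable topological space is a space $X$ together with an indexed countable base $(B_i)_{i\in\omega}$ of non-empty open sets and a c.e. set $W\subseteq\omega^3$ such that $B_i\cap B_j=\bigcup\{B_k : (i,j,k)\in W\}$ for all $i,j$. The name of a point $x$ is $N^x=\{i: x\in B_i\}$. A name of an open set $U$ is any $S\subseteq\omega$ with $U=\bigcup_{i\in S}B_i$. A map $f$ between computable topological spaces is effectively continuous if there is an enumeration operator which, given any enumeration of a name of an open set $V$ of the target, enumerates a name of $f^{-1}(V)$. A computable topological group is a group whose underlying space is a computable topological space such that multiplication $G\times G\to G$ (with the product basis) and inversion are effectively continuous. A metric is compatible if it induces the topology of $G$. *)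

theory Defs
  imports
    "HOL-Analysis.Abstract_Metric_Spaces"
    "HOL-Algebra.Group"
    "HOL-Library.Nat_Bijection"
    "HOL-Library.Countable"
begin

text \<open>
  Total recursive functions of arity \<open>n\<close>, represented as functions on lists; only the values on
  lists of length \<open>n\<close> are meaningful. Minimisation is restricted to regular functions, so every
  function of the class is total on its arity; by Kleene's normal form theorem these are exactly
  the total \<open>\<mu>\<close>-recursive functions.
\<close>

inductive recursive :: "nat \<Rightarrow> (nat list \<Rightarrow> nat) \<Rightarrow> bool" where
  zero: "recursive n (\<lambda>xs. 0)"
| succ: "recursive 1 (\<lambda>xs. Suc (hd xs))"
| proj: "i < n \<Longrightarrow> recursive n (\<lambda>xs. xs ! i)"
| comp: "recursive m f \<Longrightarrow> length gs = m \<Longrightarrow> (\<And>g. g \<in> set gs \<Longrightarrow> recursive n g) \<Longrightarrow>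
    recursive n (\<lambda>xs. f (map (\<lambda>g. g xs) gs))"
| prim_rec: "recursive n f \<Longrightarrow> recursive (n + 2) g \<Longrightarrow>
    recursive (n + 1) (\<lambda>xs. rec_nat (f (tl xs)) (\<lambda>k r. g (k # r # tl xs)) (hd xs))"
| minimisation: "recursive (n + 1) f \<Longrightarrow> (\<And>xs. length xs = n \<Longrightarrow> \<exists>k. f (k # xs) = 0) \<Longrightarrow>
    recursive n (\<lambda>xs. LEAST k. f (k # xs) = 0)"

definition computable :: "(nat \<Rightarrow> nat) \<Rightarrow> bool" where
  "computable f \<longleftrightarrow> (\<exists>g. recursive 1 g \<and> (\<forall>x. f x = g [x]))"

definition ce :: "nat set \<Rightarrow> bool" where
  "ce A \<longleftrightarrow> A = {} \<or> (\<exists>f. computable f \<and> A = range f)"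

definition ce3 :: "(nat \<times> nat \<times> nat) set \<Rightarrow> bool" where
  "ce3 W \<longleftrightarrow> ce ((\<lambda>(i, j, k). prod_encode (i, prod_encode (j, k))) ` W)"

text \<open>
  Enumeration operators in the sense of Friedberg and Rogers: \<open>W\<close> is a c.e. set of axioms
  \<open>(n, e)\<close>, read as ``enumerate \<open>n\<close> once all elements of the finite set with canonical
  index \<open>e\<close> have been enumerated in the input''.
\<close>

definition enumeration_operator :: "(nat set \<Rightarrow> nat set) \<Rightarrow> bool" where
  "enumeration_operator \<Phi> \<longleftrightarrow>
    (\<exists>W. ce W \<and> (\<forall>A. \<Phi> A = {n. \<exists>e. prod_encode (n, e) \<in> W \<and> set_decode e \<subseteq> A}))"

text \<open>
  An enumeration is a sequence \<open>p :: nat \<Rightarrow> nat option\<close>, where \<open>None\<close> means that nothing is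
  listed at that stage (so that the empty set has enumerations, too); it enumerates the set
  \<open>ran p\<close>. An enumeration operator \<open>\<Phi>\<close>, fed with \<open>p\<close>, enumerates the set \<open>\<Phi> (ran p)\<close>.
  The join of enumerations of \<open>A\<close> and \<open>B\<close> enumerates
  \<open>{2 * a | a. a \<in> A} \<union> {2 * b + 1 | b. b \<in> B}\<close>.
\<close>

definition enum_join :: "(nat \<Rightarrow> nat option) \<Rightarrow> (nat \<Rightarrow> nat option) \<Rightarrow> nat \<Rightarrow> nat option" where
  "enum_join p q n =
    (if even n then map_option (\<lambda>a. 2 * a) (p (n div 2))
     else map_option (\<lambda>b. 2 * b + 1) (q (n div 2)))"

locale computable_topological_space =
  fixes X :: "'a topology"
    and B :: "nat \<Rightarrow> 'a set"
    and W :: "(nat \<times> nat \<times> nat) set"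
  assumes hausdorff: "Hausdorff_space X"
    and base_open: "\<And>i. openin X (B i)"
    and base_nonempty: "\<And>i. B i \<noteq> {}"
    and base: "\<And>U x. openin X U \<Longrightarrow> x \<in> U \<Longrightarrow> \<exists>i. x \<in> B i \<and> B i \<subseteq> U"
    and ce_W: "ce3 W"
    and base_Int: "\<And>i j. B i \<inter> B j = \<Union>{B k | k. (i, j, k) \<in> W}"

definition point_name :: "(nat \<Rightarrow> 'a set) \<Rightarrow> 'a \<Rightarrow> nat set" where
  "point_name B x = {i. x \<in> B i}"

definition open_name :: "(nat \<Rightarrow> 'a set) \<Rightarrow> 'a set \<Rightarrow> nat set \<Rightarrow> bool" where
  "open_name B U S \<longleftrightarrow> U = (\<Union>i\<in>S. B i)"

definition product_base :: "(nat \<Rightarrow> 'a set) \<Rightarrow> (nat \<Rightarrow> 'b set) \<Rightarrow> nat \<Rightarrow> ('a \<times> 'b) set" where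
  "product_base B C n = (case prod_decode n of (i, j) \<Rightarrow> B i \<times> C j)"

definition effectively_continuous ::
  "'a topology \<Rightarrow> (nat \<Rightarrow> 'a set) \<Rightarrow> 'b topology \<Rightarrow> (nat \<Rightarrow> 'b set) \<Rightarrow> ('a \<Rightarrow> 'b) \<Rightarrow> bool" where
  "effectively_continuous X B Y C f \<longleftrightarrow>
    f \<in> topspace X \<rightarrow> topspace Y \<and>
    (\<exists>\<Phi>. enumeration_operator \<Phi> \<and>
      (\<forall>V (p :: nat \<Rightarrow> nat option). openin Y V \<longrightarrow> open_name C V (ran p) \<longrightarrow>
        open_name B {x \<in> topspace X. f x \<in> V} (\<Phi> (ran p))))"

locale computable_topological_group =
  group G + computable_topological_space X B W
  for G :: "('a, 'b) monoid_scheme" (structure)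
    and X :: "'a topology" and B :: "nat \<Rightarrow> 'a set" and W :: "(nat \<times> nat \<times> nat) set" +
  assumes topspace_eq: "topspace X = carrier G"
    and mult_effective:
      "effectively_continuous (prod_topology X X) (product_base B B) X B (\<lambda>(x, y). x \<otimes> y)"
    and inv_effective: "effectively_continuous X B X B (\<lambda>x. inv x)"

end

theory Submission
  imports Defs
begin

text \<open>
  This is the Birkhoff--Kakutani construction with effectively chosen neighbourhoods of the unit.
  The unit is a computable point: the preimage of a basic set under \<open>(x, y) \<mapsto> x\<inverse> y\<close>
  meets the diagonal iff the basic set contains the unit, and since basic sets are non-empty, this can be
  semidecided. Hence one can search for a computable sequence of basic neighbourhoods
  \<open>U\<^sub>n\<close> of the unit, which form a neighbourhood base, with \<open>(U\<^sub>n\<^sub>+\<^sub>1 \<union> U\<^sub>n\<^sub>+\<^sub>1\<inverse>)\<^sup>3 \<subseteq> U\<^sub>n\<close>.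
  The metric is the infimum of the costs of chains, a step in \<open>U\<^sub>n \<union> U\<^sub>n\<inverse>\<close> costing
  \<open>(1/2)\<^sup>n\<^sup>+\<^sup>1\<close> and an arbitrary step costing \<open>1\<close>. A chain of small cost is witnessed by
  finitely many basic rectangles of which consecutive ones overlap, so that the right cut is c.e.
\<close>

section \<open>Closure properties of computable functions\<close>

text \<open>In the classical construction neighbourhoods are shrunk and symmetrised at will. Here
  each choice must be found by search, and only positive facts can be searched for: two basic sets
  meet, a rectangle is mapped into a basic set, a basic set contains the unit. Effective continuity
  is therefore used only through relations between indices of basic sets. Symmetry is imposed by
  adjoining inverses, since the inverse of a basic set need not be basic.

  The same positivity explains why a right cut is what comes out: one chain certifies an upper bound
  for the distance, whereas a lower bound speaks about all chains. A search cannot handle the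
  intermediate points of a chain, but all pairs in a rectangle are related at once, so any common
  point of adjacent sets will do as an intermediate one.

  Cubes appear because a cheap chain is cut at one step into the part before, the step itself and
  the part after. Left invariance comes from steps that depend on \<open>inv x \<otimes> y\<close>
  only.\<close>

definition recfun :: "nat \<Rightarrow> (nat list \<Rightarrow> nat) \<Rightarrow> bool" where
  "recfun n f \<longleftrightarrow> (\<exists>g. recursive n g \<and> (\<forall>xs. length xs = n \<longrightarrow> f xs = g xs))"

text \<open>A derivation of \<open>recursive\<close> fixes the values on lists of every length.
  Ignoring the lists of wrong length makes rewriting under this congruence possible.\<close>

lemma recfun_cong:
  assumes "recfun n f" "\<And>xs. length xs = n \<Longrightarrow> f xs = g xs"
  shows "recfun n g"
  using assms unfolding recfun_def by metis

lemma recfun_zero: "recfun n (\<lambda>xs. 0)"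
  unfolding recfun_def using recursive.zero by blast

lemma recfun_nth: "i < n \<Longrightarrow> recfun n (\<lambda>xs. xs ! i)"
  unfolding recfun_def using recursive.proj by blast

lemma recfun_comp:
  assumes "recfun (length gs) f" "\<And>g. g \<in> set gs \<Longrightarrow> recfun n g"
  shows "recfun n (\<lambda>xs. f (map (\<lambda>g. g xs) gs))"
proof -
  obtain f' where f': "recursive (length gs) f'" "\<And>xs. length xs = length gs \<Longrightarrow> f xs = f' xs"
    using assms(1) unfolding recfun_def by blast
  obtain R where R: "\<And>g. g \<in> set gs \<Longrightarrow> recursive n (R g)"
      "\<And>g xs. g \<in> set gs \<Longrightarrow> length xs = n \<Longrightarrow> g xs = R g xs"
    using assms(2) unfolding recfun_def by metis
  have "recursive n (\<lambda>xs. f' (map (\<lambda>g. g xs) (map R gs)))"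
    by (rule recursive.comp[OF f'(1)]) (use R(1) in auto)
  moreover have "f (map (\<lambda>g. g xs) gs) = f' (map (\<lambda>g. g xs) (map R gs))" if "length xs = n" for xs
  proof -
    have "map (\<lambda>g. g xs) gs = map (\<lambda>g. g xs) (map R gs)"
      using R(2) that by simp
    then show ?thesis using f'(2) by (metis length_map)
  qed
  ultimately show ?thesis unfolding recfun_def by blast
qed

lemma recfun_comp1: "recfun 1 f \<Longrightarrow> recfun n g \<Longrightarrow> recfun n (\<lambda>xs. f [g xs])"
  using recfun_comp[of "[g]" f n] by simp

lemma recfun_comp2:
  "recfun 2 f \<Longrightarrow> recfun n g \<Longrightarrow> recfun n h \<Longrightarrow> recfun n (\<lambda>xs. f [g xs, h xs])"
  using recfun_comp[of "[g, h]" f n] by (auto simp: numeral_2_eq_2)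

lemma recfun_Suc: "recfun n f \<Longrightarrow> recfun n (\<lambda>xs. Suc (f xs))"
proof -
  have "recfun 1 (\<lambda>xs. Suc (hd xs))"
    unfolding recfun_def using recursive.succ by blast
  then show "recfun n f \<Longrightarrow> ?thesis" using recfun_comp1 by fastforce
qed

lemma recfun_const: "recfun n (\<lambda>xs. c)"
  by (induction c) (auto intro: recfun_zero recfun_Suc)

text \<open>\<open>prim_rec\<close> recurses on the head of the argument list. Substituting
  \<open>h\<close> for the head and all projections for the tail lets the number of rounds be any
  function of \<open>xs\<close>.\<close>

lemma recfun_rec_nat:
  assumes "recfun n f" "recfun (n + 2) g" "recfun n h"
  shows "recfun n (\<lambda>xs. rec_nat (f xs) (\<lambda>k r. g (k # r # xs)) (h xs))"
proof -
  obtain f' where f': "recursive n f'" "\<And>xs. length xs = n \<Longrightarrow> f xs = f' xs"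
    using assms(1) unfolding recfun_def by blast
  obtain g' where g': "recursive (n + 2) g'" "\<And>xs. length xs = n + 2 \<Longrightarrow> g xs = g' xs"
    using assms(2) unfolding recfun_def by blast
  let ?F = "\<lambda>xs. rec_nat (f' (tl xs)) (\<lambda>k r. g' (k # r # tl xs)) (hd xs)"
  let ?gs = "h # map (\<lambda>i xs. xs ! i) [0..<n]"
  have "recfun (length ?gs) ?F"
    using recursive.prim_rec[OF f'(1) g'(1)] unfolding recfun_def by auto
  then have "recfun n (\<lambda>xs. ?F (map (\<lambda>g. g xs) ?gs))"
    by (rule recfun_comp) (auto intro: recfun_nth assms(3))
  then show ?thesis
  proof (rule recfun_cong)
    fix xs :: "nat list" assume len: "length xs = n"
    then have "map (\<lambda>g. g xs) ?gs = h xs # xs"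
      using map_nth[of xs] by (simp add: comp_def)
    then show "?F (map (\<lambda>g. g xs) ?gs) = rec_nat (f xs) (\<lambda>k r. g (k # r # xs)) (h xs)"
      using f'(2) g'(2) len by simp
  qed
qed

lemma recfun_Least:
  assumes "recfun (n + 1) f" "\<And>xs. length xs = n \<Longrightarrow> \<exists>k. f (k # xs) = 0"
  shows "recfun n (\<lambda>xs. LEAST k. f (k # xs) = 0)"
proof -
  obtain f' where f': "recursive (n + 1) f'" "\<And>xs. length xs = n + 1 \<Longrightarrow> f xs = f' xs"
    using assms(1) unfolding recfun_def by blast
  have "recursive n (\<lambda>xs. LEAST k. f' (k # xs) = 0)"
    by (rule recursive.minimisation[OF f'(1)]) (use f'(2) assms(2) in force)
  then show ?thesis
    unfolding recfun_def by (intro exI conjI) (auto simp: f'(2))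
qed

lemma recfun_add: "recfun n f \<Longrightarrow> recfun n g \<Longrightarrow> recfun n (\<lambda>xs. f xs + g xs)"
proof -
  have "rec_nat a (\<lambda>k r. Suc r) b = a + b" for a b :: nat
    by (induction b) auto
  then show "recfun n f \<Longrightarrow> recfun n g \<Longrightarrow> ?thesis"
    using recfun_rec_nat[OF _ recfun_Suc[OF recfun_nth[of 1 "n + 2"]], of f g] by simp
qed

lemma recfun_pred: "recfun n f \<Longrightarrow> recfun n (\<lambda>xs. f xs - 1)"
proof -
  have "rec_nat 0 (\<lambda>k r. k) b = b - 1" for b :: nat
    by (cases b) auto
  then show "recfun n f \<Longrightarrow> ?thesis"
    using recfun_rec_nat[OF recfun_zero recfun_nth[of 0 "n + 2"], of f] by simp
qed

lemma recfun_diff: "recfun n f \<Longrightarrow> recfun n g \<Longrightarrow> recfun n (\<lambda>xs. f xs - g xs)"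
proof -
  have "rec_nat a (\<lambda>k r. r - 1) b = a - b" for a b :: nat
    by (induction b) auto
  then show "recfun n f \<Longrightarrow> recfun n g \<Longrightarrow> ?thesis"
    using recfun_rec_nat[OF _ recfun_pred[OF recfun_nth[of 1 "n + 2"]], of f g] by simp
qed

lemma recfun_mult: "recfun n f \<Longrightarrow> recfun n g \<Longrightarrow> recfun n (\<lambda>xs. f xs * g xs)"
proof -
  have rec: "rec_nat 0 (\<lambda>k r. r + a) b = a * b" for a b :: nat
    by (induction b) auto
  \<comment> \<open>In \<open>k # r # xs\<close>, position 1 is the accumulator and position 2 the
    first argument.\<close>
  have "recfun (2 + 2) (\<lambda>ys. ys ! 1 + ys ! 2)"
    by (intro recfun_add recfun_nth) auto
  from recfun_rec_nat[OF recfun_zero this recfun_nth[of 1 2]]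
  have "recfun 2 (\<lambda>xs. xs ! 0 * xs ! 1)"
    by (simp add: rec)
  then show "recfun n f \<Longrightarrow> recfun n g \<Longrightarrow> ?thesis"
    using recfun_comp2 by fastforce
qed

lemma recfun_triangle: "recfun n f \<Longrightarrow> recfun n (\<lambda>xs. triangle (f xs))"
proof -
  have rec: "rec_nat 0 (\<lambda>k r. r + Suc k) b = triangle b" for b :: nat
    by (induction b) auto
  have "recfun (n + 2) (\<lambda>ys. ys ! 1 + Suc (ys ! 0))"
    by (intro recfun_add recfun_Suc recfun_nth) auto
  from recfun_rec_nat[OF recfun_zero this, of f]
  show "recfun n f \<Longrightarrow> ?thesis"
    using rec by simp
qed

section \<open>Inverting the Cantor pairing\<close>

definition cpair :: "nat \<Rightarrow> nat \<Rightarrow> nat" where "cpair x y = prod_encode (x, y)"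
definition cfst :: "nat \<Rightarrow> nat" where "cfst z = fst (prod_decode z)"
definition csnd :: "nat \<Rightarrow> nat" where "csnd z = snd (prod_decode z)"

lemma cfst_cpair [simp]: "cfst (cpair x y) = x"
  and csnd_cpair [simp]: "csnd (cpair x y) = y"
  and cpair_cfst_csnd [simp]: "cpair (cfst z) (csnd z) = z"
  by (auto simp: cpair_def cfst_def csnd_def)

lemma recfun_cpair: "recfun n f \<Longrightarrow> recfun n g \<Longrightarrow> recfun n (\<lambda>xs. cpair (f xs) (g xs))"
  unfolding cpair_def prod_encode_def by (simp add: recfun_add recfun_triangle)

text \<open>\<open>prod_encode (m, n)\<close> is \<open>triangle (m + n) + m\<close>, so a bounded
  position on the diagonal \<open>m + n\<close> determines the pair. Truncated subtraction expresses
  \<open>z < triangle (Suc s)\<close> as the vanishing of a term, the form that minimisation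
  requires.\<close>

definition diagonal_of :: "nat \<Rightarrow> nat" where
  "diagonal_of z = (LEAST s. Suc z - triangle (Suc s) = 0)"

lemma less_triangle_Suc: "z < triangle (Suc z)"
  by (induction z) auto

lemma triangle_mono: "m \<le> n \<Longrightarrow> triangle m \<le> triangle n"
  by (induction rule: dec_induct) auto

lemma diagonal_of_cpair: "diagonal_of (cpair m n) = m + n"
  unfolding diagonal_of_def
proof (rule Least_equality)
  show "Suc (cpair m n) - triangle (Suc (m + n)) = 0"
    by (simp add: cpair_def prod_encode_def)
next
  fix s assume *: "Suc (cpair m n) - triangle (Suc s) = 0"
  show "m + n \<le> s"
  proof (rule ccontr)
    assume "\<not> m + n \<le> s"
    then have "triangle (Suc s) \<le> triangle (m + n)" by (intro triangle_mono) auto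
    with * show False by (simp add: cpair_def prod_encode_def)
  qed
qed

lemma recfun_diagonal_of: "recfun n f \<Longrightarrow> recfun n (\<lambda>xs. diagonal_of (f xs))"
proof -
  have "recfun (1 + 1) (\<lambda>xs. Suc (xs ! 1) - triangle (Suc (xs ! 0)))"
    by (intro recfun_diff recfun_Suc recfun_triangle recfun_nth) auto
  moreover have "\<exists>k. Suc ((k # xs) ! 1) - triangle (Suc ((k # xs) ! 0)) = 0" for xs
    using less_triangle_Suc[of "xs ! 0"] by (intro exI[of _ "xs ! 0"]) simp
  ultimately have "recfun 1 (\<lambda>xs. LEAST k. Suc ((k # xs) ! 1) - triangle (Suc ((k # xs) ! 0)) = 0)"
    by (rule recfun_Least)
  then have "recfun 1 (\<lambda>xs. diagonal_of (xs ! 0))"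
    by (simp add: diagonal_of_def)
  then show "recfun n f \<Longrightarrow> ?thesis"
    using recfun_comp1 by fastforce
qed

lemma cfst_eq: "cfst z = z - triangle (diagonal_of z)"
proof -
  have "cfst (cpair m n) = cpair m n - triangle (diagonal_of (cpair m n))" for m n
    by (simp only: diagonal_of_cpair cfst_cpair) (simp add: cpair_def prod_encode_def)
  then show ?thesis by (metis cpair_cfst_csnd)
qed

lemma csnd_eq: "csnd z = diagonal_of z - cfst z"
  by (metis add_diff_cancel_left' cpair_cfst_csnd diagonal_of_cpair)

lemma recfun_cfst: "recfun n f \<Longrightarrow> recfun n (\<lambda>xs. cfst (f xs))"
  unfolding cfst_eq by (intro recfun_diff recfun_triangle recfun_diagonal_of)

lemma recfun_csnd: "recfun n f \<Longrightarrow> recfun n (\<lambda>xs. csnd (f xs))"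
  unfolding csnd_eq by (intro recfun_diff recfun_cfst recfun_diagonal_of)

section \<open>Unary computable functions, with several arguments coded in pairs\<close>

lemma computable_iff_recfun: "computable f \<longleftrightarrow> recfun 1 (\<lambda>xs. f (xs ! 0))"
proof
  assume "computable f"
  then obtain g where g: "recursive 1 g" "\<And>x. f x = g [x]"
    unfolding computable_def by blast
  have "f (xs ! 0) = g xs" if "length xs = 1" for xs
    using that g(2) by (cases xs) auto
  with g(1) show "recfun 1 (\<lambda>xs. f (xs ! 0))"
    unfolding recfun_def by blast
next
  assume "recfun 1 (\<lambda>xs. f (xs ! 0))"
  then obtain g where "recursive 1 g" "\<And>xs. length xs = 1 \<Longrightarrow> f (xs ! 0) = g xs"
    unfolding recfun_def by blast
  moreover from this(2)[of "[_]"] have "f x = g [x]" for x by simp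
  ultimately show "computable f"
    unfolding computable_def by blast
qed

lemma recfun_computable: "computable f \<Longrightarrow> recfun n g \<Longrightarrow> recfun n (\<lambda>xs. f (g xs))"
  unfolding computable_iff_recfun by (drule recfun_comp1[of _ n g]) auto

named_theorems computable_intros

lemma computable_comp: "computable f \<Longrightarrow> computable g \<Longrightarrow> computable (\<lambda>x. f (g x))"
  unfolding computable_iff_recfun[of g] computable_iff_recfun[of "\<lambda>x. f (g x)"]
  by (rule recfun_computable)

lemma computable_basic [computable_intros]:
  "computable (\<lambda>x. x)"
  "computable (\<lambda>x. c)"
  "computable f \<Longrightarrow> computable (\<lambda>x. Suc (f x))"
  "computable f \<Longrightarrow> computable g \<Longrightarrow> computable (\<lambda>x. f x + g x)"
  "computable f \<Longrightarrow> computable g \<Longrightarrow> computable (\<lambda>x. f x - g x)"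
  "computable f \<Longrightarrow> computable g \<Longrightarrow> computable (\<lambda>x. f x * g x)"
  "computable f \<Longrightarrow> computable g \<Longrightarrow> computable (\<lambda>x. cpair (f x) (g x))"
  "computable f \<Longrightarrow> computable (\<lambda>x. cfst (f x))"
  "computable f \<Longrightarrow> computable (\<lambda>x. csnd (f x))"
  unfolding computable_iff_recfun
  by (intro recfun_nth recfun_const recfun_Suc recfun_add recfun_diff recfun_mult recfun_cpair
      recfun_cfst recfun_csnd; simp)+

text \<open>The step function has three arguments, the round, the previous value and the parameter.
  Since \<open>computable\<close> is unary, its hypothesis reads them off nested pairs.\<close>

lemma computable_rec_nat [computable_intros]:
  assumes "computable f" "computable (\<lambda>z. g (cfst z) (cfst (csnd z)) (csnd (csnd z)))" "computable h"
  shows "computable (\<lambda>x. rec_nat (f x) (\<lambda>k r. g k r x) (h x))"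
proof -
  let ?g = "\<lambda>z. g (cfst z) (cfst (csnd z)) (csnd (csnd z))"
  have "recfun (1 + 2) (\<lambda>ys. ?g (cpair (ys ! 0) (cpair (ys ! 1) (ys ! 2))))"
    by (intro recfun_computable[OF assms(2)] recfun_cpair recfun_nth) auto
  from recfun_rec_nat[OF _ this] assms(1,3) show ?thesis
    unfolding computable_iff_recfun by fastforce
qed

lemma computable_Least:
  assumes "computable (\<lambda>z. f (cfst z) (csnd z))" "\<And>x. \<exists>k. f k x = 0"
  shows "computable (\<lambda>x. LEAST k. f k x = 0)"
proof -
  let ?f = "\<lambda>z. f (cfst z) (csnd z)"
  have "recfun (1 + 1) (\<lambda>ys. ?f (cpair (ys ! 0) (ys ! 1)))"
    by (intro recfun_computable[OF assms(1)] recfun_cpair recfun_nth) auto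
  from recfun_Least[OF this] assms(2) show ?thesis
    unfolding computable_iff_recfun by simp
qed

lemma computable_power2 [computable_intros]:
  assumes "computable f"
  shows "computable (\<lambda>x. 2 ^ f x)"
proof -
  have "computable (\<lambda>x. rec_nat 1 (\<lambda>k r. 2 * r) (f x))"
    by (intro computable_intros assms)
  moreover have "rec_nat 1 (\<lambda>k r. 2 * r) b = (2::nat) ^ b" for b :: nat
    by (induction b) auto
  ultimately show ?thesis by simp
qed

lemma computable_sum [computable_intros]:
  assumes "computable (\<lambda>z. f (cfst z) (csnd z))" "computable h"
  shows "computable (\<lambda>x. \<Sum>t<h x. f t x)"
proof -
  have "computable (\<lambda>z. f (cfst z) (csnd (csnd z)))"
    using computable_comp[OF assms(1), of "\<lambda>z. cpair (cfst z) (csnd (csnd z))"]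
    by (simp add: computable_intros)
  then have "computable (\<lambda>x. rec_nat 0 (\<lambda>k r. r + f k x) (h x))"
    by (intro computable_intros assms)
  moreover have "rec_nat 0 (\<lambda>k r. r + f k x) b = (\<Sum>t<b. f t x)" for b x
    by (induction b) auto
  ultimately show ?thesis by simp
qed

text \<open>No length is stored: every number codes an infinite sequence of iterated first
  components, and each finite sequence is an initial segment of a coded one.\<close>

definition seq_nth :: "nat \<Rightarrow> nat \<Rightarrow> nat" where
  "seq_nth c t = cfst (rec_nat c (\<lambda>k r. csnd r) t)"

lemma computable_seq_nth [computable_intros]:
  "computable f \<Longrightarrow> computable g \<Longrightarrow> computable (\<lambda>x. seq_nth (f x) (g x))"
  unfolding seq_nth_def by (intro computable_intros)

lemma seq_nth_exists: "\<exists>c. \<forall>t<n. seq_nth c t = f t"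
proof (induction n arbitrary: f)
  case (Suc n)
  obtain c where c: "\<forall>t<n. seq_nth c t = f (Suc t)"
    using Suc.IH[of "\<lambda>t. f (Suc t)"] by blast
  have "rec_nat (cpair a c) (\<lambda>k r. csnd r) (Suc t) = rec_nat c (\<lambda>k r. csnd r) t" for a t
    by (induction t) auto
  then have "seq_nth (cpair (f 0) c) (Suc t) = seq_nth c t" for t
    by (simp add: seq_nth_def)
  moreover have "seq_nth (cpair (f 0) c) 0 = f 0"
    by (simp add: seq_nth_def)
  ultimately have "\<forall>t<Suc n. seq_nth (cpair (f 0) c) t = f t"
    using c by (auto simp: less_Suc_eq_0_disj)
  then show ?case by blast
qed auto

section \<open>Semidecidable predicates\<close>

text \<open>With zeros as certificates the connectives become arithmetic: a sum of values for
  conjunction, a product for disjunction, and a sum over all instances for bounded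
  quantifiers.\<close>

definition semidecidable :: "(nat \<Rightarrow> bool) \<Rightarrow> bool" where
  "semidecidable P \<longleftrightarrow> (\<exists>f. computable f \<and> (\<forall>x. P x \<longleftrightarrow> (\<exists>k. f (cpair k x) = 0)))"

named_theorems semidecidable_intros

lemma semidecidableI:
  assumes "computable (\<lambda>z. f (cfst z) (csnd z))" "\<And>x. P x \<longleftrightarrow> (\<exists>k. f k x = 0)"
  shows "semidecidable P"
  using assms unfolding semidecidable_def by force

lemma semidecidableE:
  assumes "semidecidable P"
  obtains f where "computable (\<lambda>z. f (cfst z) (csnd z))" "\<And>x. P x \<longleftrightarrow> (\<exists>k. f k x = 0)"
proof -
  obtain f where "computable f" "\<And>x. P x \<longleftrightarrow> (\<exists>k. f (cpair k x) = 0)"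
    using assms unfolding semidecidable_def by blast
  then show ?thesis by (intro that[of "\<lambda>k x. f (cpair k x)"]) auto
qed

lemma semidecidable_comp: "semidecidable P \<Longrightarrow> computable f \<Longrightarrow> semidecidable (\<lambda>x. P (f x))"
proof (erule semidecidableE)
  fix g assume "computable f" and g: "computable (\<lambda>z. g (cfst z) (csnd z))" "\<And>x. P x \<longleftrightarrow> (\<exists>k. g k x = 0)"
  then have "computable (\<lambda>z. g (cfst z) (f (csnd z)))"
    using computable_comp[OF g(1), of "\<lambda>z. cpair (cfst z) (f (csnd z))"]
    by (simp add: computable_intros computable_comp[of f])
  then show ?thesis
    by (rule semidecidableI[of "\<lambda>k x. g k (f x)"]) (simp add: g(2))
qed

lemma semidecidable_comp2:
  assumes "semidecidable (\<lambda>z. R (cfst z) (csnd z))" "computable f" "computable g"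
  shows "semidecidable (\<lambda>x. R (f x) (g x))"
  using semidecidable_comp[OF assms(1), of "\<lambda>x. cpair (f x) (g x)"] assms(2,3)
  by (simp add: computable_intros)

lemma semidecidable_comp3:
  assumes "semidecidable (\<lambda>z. R (cfst z) (cfst (csnd z)) (csnd (csnd z)))"
    "computable f" "computable g" "computable h"
  shows "semidecidable (\<lambda>x. R (f x) (g x) (h x))"
  using semidecidable_comp[OF assms(1), of "\<lambda>x. cpair (f x) (cpair (g x) (h x))"] assms(2-4)
  by (simp add: computable_intros)

lemma semidecidable_const: "semidecidable (\<lambda>x. P)"
  by (rule semidecidableI[of "\<lambda>k x. if P then 0 else 1"]) (auto intro: computable_intros)

lemma semidecidable_eq [semidecidable_intros]:
  assumes "computable f" "computable g" shows "semidecidable (\<lambda>x. f x = g x)"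
  by (rule semidecidableI[of "\<lambda>k x. (f x - g x) + (g x - f x)"])
    (auto intro!: computable_intros assms[THEN computable_comp])

lemma semidecidable_less [semidecidable_intros]:
  assumes "computable f" "computable g" shows "semidecidable (\<lambda>x. f x < g x)"
  by (rule semidecidableI[of "\<lambda>k x. Suc (f x) - g x"])
    (auto intro!: computable_intros assms[THEN computable_comp])

lemma semidecidable_le [semidecidable_intros]:
  assumes "computable f" "computable g" shows "semidecidable (\<lambda>x. f x \<le> g x)"
  by (rule semidecidableI[of "\<lambda>k x. f x - g x"])
    (auto intro!: computable_intros assms[THEN computable_comp])

lemma semidecidable_Ex [semidecidable_intros]:
  assumes "semidecidable (\<lambda>z. P (cfst z) (csnd z))"
  shows "semidecidable (\<lambda>x. \<exists>k. P k x)"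
proof -
  obtain f where f: "computable (\<lambda>z. f (cfst z) (csnd z))"
      "\<And>z. P (cfst z) (csnd z) \<longleftrightarrow> (\<exists>k. f k z = 0)"
    using assms by (rule semidecidableE) blast
  have "computable (\<lambda>z. f (cfst (cfst z)) (cpair (csnd (cfst z)) (csnd z)))"
    using computable_comp[OF f(1), of "\<lambda>z. cpair (cfst (cfst z)) (cpair (csnd (cfst z)) (csnd z))"]
    by (simp add: computable_intros)
  moreover have "(\<exists>k. P k x) \<longleftrightarrow> (\<exists>k. f (cfst k) (cpair (csnd k) x) = 0)" for x
    using f(2)[of "cpair _ x"] by (metis cfst_cpair csnd_cpair)
  ultimately show ?thesis
    by (rule semidecidableI[of "\<lambda>k x. f (cfst k) (cpair (csnd k) x)"])
qed

lemma semidecidable_conj [semidecidable_intros]: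
  assumes "semidecidable P" "semidecidable Q"
  shows "semidecidable (\<lambda>x. P x \<and> Q x)"
proof -
  obtain f where f: "computable (\<lambda>z. f (cfst z) (csnd z))" "\<And>x. P x \<longleftrightarrow> (\<exists>k. f k x = 0)"
    using assms(1) by (rule semidecidableE) blast
  obtain g where g: "computable (\<lambda>z. g (cfst z) (csnd z))" "\<And>x. Q x \<longleftrightarrow> (\<exists>k. g k x = 0)"
    using assms(2) by (rule semidecidableE) blast
  have "computable (\<lambda>z. f (cfst (cfst z)) (csnd z) + g (csnd (cfst z)) (csnd z))"
    using computable_comp[OF f(1), of "\<lambda>z. cpair (cfst (cfst z)) (csnd z)"]
      computable_comp[OF g(1), of "\<lambda>z. cpair (csnd (cfst z)) (csnd z)"]
    by (simp add: computable_intros)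
  moreover have "(P x \<and> Q x) \<longleftrightarrow> (\<exists>k. f (cfst k) x + g (csnd k) x = 0)" for x
    unfolding f(2) g(2) by simp (metis cfst_cpair csnd_cpair)
  ultimately show ?thesis
    by (rule semidecidableI[of "\<lambda>k x. f (cfst k) x + g (csnd k) x"])
qed

lemma semidecidable_disj [semidecidable_intros]:
  assumes "semidecidable P" "semidecidable Q"
  shows "semidecidable (\<lambda>x. P x \<or> Q x)"
proof -
  obtain f where f: "computable (\<lambda>z. f (cfst z) (csnd z))" "\<And>x. P x \<longleftrightarrow> (\<exists>k. f k x = 0)"
    using assms(1) by (rule semidecidableE) blast
  obtain g where g: "computable (\<lambda>z. g (cfst z) (csnd z))" "\<And>x. Q x \<longleftrightarrow> (\<exists>k. g k x = 0)"
    using assms(2) by (rule semidecidableE) blast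
  have "computable (\<lambda>z. f (cfst z) (csnd z) * g (cfst z) (csnd z))"
    by (intro computable_intros f g)
  moreover have "(P x \<or> Q x) \<longleftrightarrow> (\<exists>k. f k x * g k x = 0)" for x
    unfolding f(2) g(2) by auto
  ultimately show ?thesis
    by (rule semidecidableI[of "\<lambda>k x. f k x * g k x"])
qed

text \<open>Collection: the witnesses for all \<open>t < b x\<close> are gathered in one sequence code.\<close>

lemma semidecidable_bounded_all [semidecidable_intros]:
  assumes "semidecidable (\<lambda>z. P (cfst z) (csnd z))" "computable b"
  shows "semidecidable (\<lambda>x. \<forall>t<b x. P t x)"
proof -
  obtain f where f: "computable (\<lambda>z. f (cfst z) (csnd z))"
      "\<And>z. P (cfst z) (csnd z) \<longleftrightarrow> (\<exists>k. f k z = 0)"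
    using assms(1) by (rule semidecidableE) blast
  let ?F = "\<lambda>c t x. f (seq_nth c t) (cpair t x)"
  have "computable (\<lambda>z. ?F (cfst (csnd z)) (cfst z) (csnd (csnd z)))"
    using computable_comp[OF f(1),
        of "\<lambda>z. cpair (seq_nth (cfst (csnd z)) (cfst z)) (cpair (cfst z) (csnd (csnd z)))"]
    by (simp add: computable_intros)
  then have "computable (\<lambda>z. \<Sum>t<b (csnd z). ?F (cfst z) t (csnd z))"
    by (intro computable_sum computable_comp[OF assms(2)] computable_intros)
  moreover have "(\<forall>t<b x. P t x) \<longleftrightarrow> (\<exists>c. (\<Sum>t<b x. ?F c t x) = 0)" for x
  proof
    assume "\<forall>t<b x. P t x"
    then have "\<forall>t<b x. \<exists>k. f k (cpair t x) = 0"
      using f(2)[of "cpair _ x"] by simp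
    then obtain w where w: "\<forall>t<b x. f (w t) (cpair t x) = 0" by metis
    obtain c where "\<forall>t<b x. seq_nth c t = w t" using seq_nth_exists by blast
    with w show "\<exists>c. (\<Sum>t<b x. ?F c t x) = 0" by (intro exI[of _ c]) simp
  next
    assume "\<exists>c. (\<Sum>t<b x. ?F c t x) = 0"
    then show "\<forall>t<b x. P t x"
      using f(2)[of "cpair _ x"] by auto
  qed
  ultimately show ?thesis
    by (rule semidecidableI[of "\<lambda>k x. \<Sum>t<b x. f (seq_nth k t) (cpair t x)"])
qed

text \<open>Testing values one after the other could get stuck at a wrong one. Searching for a
  certificate and a value at the same time, coded as one pair, always ends.\<close>

lemma semidecidable_uniformization:
  assumes "semidecidable (\<lambda>z. P (cfst z) (csnd z))" "\<And>x. \<exists>y. P x y"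
  shows "\<exists>f. computable f \<and> (\<forall>x. P x (f x))"
proof -
  obtain f where f: "computable (\<lambda>z. f (cfst z) (csnd z))"
      "\<And>z. P (cfst z) (csnd z) \<longleftrightarrow> (\<exists>k. f k z = 0)"
    using assms(1) by (rule semidecidableE) blast
  let ?F = "\<lambda>k x. f (cfst k) (cpair x (csnd k))"
  have ex: "\<exists>k. ?F k x = 0" for x
    using assms(2)[of x] f(2)[of "cpair x _"] by (metis cfst_cpair csnd_cpair)
  have "computable (\<lambda>z. ?F (cfst z) (csnd z))"
    using computable_comp[OF f(1), of "\<lambda>z. cpair (cfst (cfst z)) (cpair (csnd z) (csnd (cfst z)))"]
    by (simp add: computable_intros)
  then have "computable (\<lambda>x. LEAST k. ?F k x = 0)"
    using ex by (rule computable_Least)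
  then have "computable (\<lambda>x. csnd (LEAST k. ?F k x = 0))"
    by (rule computable_intros)
  moreover have "P x (csnd (LEAST k. ?F k x = 0))" for x
    using LeastI_ex[OF ex[of x]] f(2)[of "cpair x _"] by (metis cfst_cpair csnd_cpair)
  ultimately show ?thesis by blast
qed

lemma semidecidable_if_ce: "ce A \<Longrightarrow> semidecidable (\<lambda>x. x \<in> A)"
proof -
  assume "ce A"
  then consider "A = {}" | f where "computable f" "A = range f"
    unfolding ce_def by blast
  then show ?thesis
  proof cases
    case 1
    then show ?thesis using semidecidable_const[of False] by simp
  next
    case 2
    have "semidecidable (\<lambda>x. \<exists>k. x = f k)"
      by (intro semidecidable_intros computable_intros computable_comp[OF 2(1)])
    then show ?thesis using 2 by (simp add: image_iff)
  qed
qed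

lemma ce_if_semidecidable:
  assumes "semidecidable P" shows "ce {x. P x}"
proof (cases "\<exists>a. P a")
  case True
  then obtain a where a: "P a" by blast
  obtain f where f: "computable (\<lambda>z. f (cfst z) (csnd z))" "\<And>x. P x \<longleftrightarrow> (\<exists>k. f k x = 0)"
    using assms by (rule semidecidableE) blast
  \<comment> \<open>The recursion is a case distinction: a pair of a valid certificate and
    \<open>x\<close> yields \<open>x\<close>, any other pair yields the fixed member
    \<open>a\<close>.\<close>
  let ?g = "\<lambda>z. rec_nat (csnd z) (\<lambda>k r. a) (f (cfst z) (csnd z))"
  have "computable ?g"
    by (intro computable_intros f(1))
  moreover have "{x. P x} = range ?g"
  proof (intro equalityI subsetI)
    fix x assume "x \<in> {x. P x}"
    then obtain k where "f k x = 0" using f(2) by auto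
    then have "x = ?g (cpair k x)" by simp
    then show "x \<in> range ?g" by blast
  next
    fix x assume "x \<in> range ?g"
    then obtain z where z: "x = ?g z" by blast
    show "x \<in> {x. P x}"
      using a f(2) z by (cases "f (cfst z) (csnd z)") auto
  qed
  ultimately show ?thesis unfolding ce_def by blast
qed (simp add: ce_def)

section \<open>The chain metric of a sequence of entourages\<close>

text \<open>The hypotheses of the metrization lemma for a separated uniformity with a countable
  base, free of the group. As \<open>E 0\<close> relates all points of \<open>M\<close>, any two of
  them are joined by a chain of cost 1.\<close>

locale entourage_sequence =
  fixes M :: "'a set" and E :: "nat \<Rightarrow> 'a \<Rightarrow> 'a \<Rightarrow> bool"
  assumes E_0: "x \<in> M \<Longrightarrow> y \<in> M \<Longrightarrow> E 0 x y"
    and E_refl: "x \<in> M \<Longrightarrow> E n x x"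
    and E_sym: "E n x y \<Longrightarrow> E n y x"
    and E_carrier: "E n x y \<Longrightarrow> x \<in> M"
    and E_cube: "E (Suc n) x y \<Longrightarrow> E (Suc n) y z \<Longrightarrow> E (Suc n) z w \<Longrightarrow> E n x w"
    and E_separates: "x \<in> M \<Longrightarrow> y \<in> M \<Longrightarrow> (\<And>n. E n x y) \<Longrightarrow> x = y"
begin

lemma E_carrier2: "E n x y \<Longrightarrow> y \<in> M"
  using E_sym E_carrier by blast

lemma E_mono: "E n x y \<Longrightarrow> m \<le> n \<Longrightarrow> E m x y"
proof (induction n)
  case (Suc n)
  have "E n x y"
    using E_cube[OF Suc.prems(1) E_refl E_refl] E_carrier2 Suc.prems(1) by blast
  with Suc show ?case by (cases "m = Suc n") auto
qed auto

text \<open>Split the interval at the last point where the partial sum is at most half of the total: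
  the parts on both sides of the step at that point cost less than \<open>(1/2)^(m+1)\<close> each.\<close>

lemma chain_short:
  fixes s :: "nat \<Rightarrow> nat"
  assumes "\<And>t. a \<le> t \<Longrightarrow> t < b \<Longrightarrow> E (s t) (g t) (g (Suc t))" "a \<le> b" "g a \<in> M"
    and "(\<Sum>t=a..<b. (1/2) ^ s t :: real) < (1/2) ^ m"
  shows "E m (g a) (g b)"
  using assms
proof (induction "b - a" arbitrary: a b m rule: less_induct)
  case less
  let ?c = "\<lambda>u v. \<Sum>t=u..<v. (1/2) ^ s t :: real"
  show ?case
  proof (cases "a = b")
    case True
    with less show ?thesis using E_refl by simp
  next
    case False
    then have "a < b" using less.prems by simp
    have split: "?c u w = ?c u v + ?c v w" if "u \<le> v" "v \<le> w" for u v w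
      using that by (simp add: sum.atLeastLessThan_concat)
    have pos: "?c u v \<ge> 0" for u v by (simp add: sum_nonneg)
    have tot: "?c a b > 0"
      using \<open>a < b\<close> by (intro sum_pos) auto
    define J where "J = {j. a \<le> j \<and> j < b \<and> ?c a j \<le> ?c a b / 2}"
    have J: "finite J" "a \<in> J"
      using \<open>a < b\<close> tot by (auto simp: J_def)
    define j where "j = Max J"
    have "j \<in> J" using Max_in[of J] J unfolding j_def by blast
    then have j: "a \<le> j" "j < b" "?c a j \<le> ?c a b / 2"
      by (auto simp: J_def)
    \<comment> \<open>For \<open>Suc j < b\<close> this is the maximality of \<open>j\<close>. The
      set \<open>J\<close> excludes \<open>b\<close>, so for \<open>Suc j = b\<close> it rests on
      the total being positive.\<close>
    have "?c a (Suc j) > ?c a b / 2"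
    proof (cases "Suc j = b")
      case False
      then have "Suc j < b" using j by simp
      show ?thesis
      proof (rule ccontr)
        assume "\<not> ?thesis"
        then have "Suc j \<in> J" using j \<open>Suc j < b\<close> by (auto simp: J_def)
        then have "Suc j \<le> j" using J(1) by (simp add: j_def)
        then show False by simp
      qed
    qed (use tot in simp)
    then have right: "?c (Suc j) b < (1/2) ^ Suc m"
      using split[of a "Suc j" b] j less.prems(4) by simp
    have left: "?c a j < (1/2) ^ Suc m"
      using j(3) less.prems(4) by simp
    \<comment> \<open>The step at the cut costs at most the total, which is strictly below
      \<open>(1/2) ^ m\<close>; so its level is at least \<open>Suc m\<close>, as the cube rule
      needs.\<close>
    have "?c j (Suc j) \<le> ?c a b"
      using split[of a j b] split[of j "Suc j" b] j pos[of a j] pos[of "Suc j" b] by linarith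
    also have "?c j (Suc j) = (1/2) ^ s j" by simp
    finally have "(1/2 :: real) ^ s j < (1/2) ^ m"
      using less.prems(4) by (rule order.strict_trans1)
    then have "m < s j"
      by (simp add: power_strict_decreasing_iff)
    have mid: "E (Suc m) (g j) (g (Suc j))"
      by (rule E_mono[OF less.prems(1)]) (use j \<open>m < s j\<close> in auto)
    have l: "E (Suc m) (g a) (g j)"
      by (rule less.hyps) (use j left less.prems in auto)
    have r: "E (Suc m) (g (Suc j)) (g b)"
      by (rule less.hyps) (use j right less.prems mid E_carrier2 in auto)
    from l mid r show ?thesis by (rule E_cube)
  qed
qed

section \<open>Chains, their costs and the metric\<close>

definition chain :: "nat \<Rightarrow> (nat \<Rightarrow> nat) \<Rightarrow> (nat \<Rightarrow> 'a) \<Rightarrow> 'a \<Rightarrow> 'a \<Rightarrow> bool" where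
  "chain k s g x y \<longleftrightarrow> g 0 = x \<and> g k = y \<and> (\<forall>t<k. E (s t) (g t) (g (Suc t)))"

definition costs :: "'a \<Rightarrow> 'a \<Rightarrow> real set" where
  "costs x y = {\<Sum>t<k. (1/2) ^ s t | k s. \<exists>g. chain k s g x y}"

text \<open>Outside \<open>M\<close> there may be no chain at all, yet \<open>Metric_space\<close>
  asks for non-negativity and symmetry at all arguments; the default 0 provides both.\<close>

definition dist_chain :: "'a \<Rightarrow> 'a \<Rightarrow> real" where
  "dist_chain x y = (if x \<in> M \<and> y \<in> M then Inf (costs x y) else 0)"

lemma costsI: "chain k s g x y \<Longrightarrow> (\<Sum>t<k. (1/2) ^ s t) \<in> costs x y"
  unfolding costs_def by blast

lemma costs_nonneg: "c \<in> costs x y \<Longrightarrow> 0 \<le> c"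
  by (auto simp: costs_def intro!: sum_nonneg)

lemma bdd_below_costs: "bdd_below (costs x y)"
  using costs_nonneg by (intro bdd_belowI[of _ 0])

lemma costs_single: "E n x y \<Longrightarrow> (1/2) ^ n \<in> costs x y"
  unfolding costs_def chain_def
  by (simp, intro exI[of _ "1::nat"] exI[of _ "\<lambda>_. n"] conjI exI[of _ "\<lambda>t. if t = 0 then x else y"])
    auto

lemma costs_nonempty: "x \<in> M \<Longrightarrow> y \<in> M \<Longrightarrow> costs x y \<noteq> {}"
  using costs_single[OF E_0] by blast

lemma costs_refl: "0 \<in> costs x x"
  unfolding costs_def chain_def
  by (simp, intro exI[of _ "0::nat"] exI[of _ "\<lambda>_. 0"] conjI exI[of _ "\<lambda>t. x"]) auto

lemma costs_sym: "c \<in> costs x y \<Longrightarrow> c \<in> costs y x"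
proof -
  assume "c \<in> costs x y"
  then obtain k s g where c: "c = (\<Sum>t<k. (1/2) ^ s t)" and ch: "chain k s g x y"
    by (auto simp: costs_def)
  have "chain k (\<lambda>t. s (k - Suc t)) (\<lambda>t. g (k - t)) y x"
    unfolding chain_def
  proof (intro conjI allI impI)
    fix t assume "t < k"
    then have "E (s (k - Suc t)) (g (k - Suc t)) (g (Suc (k - Suc t)))"
      using ch unfolding chain_def by (metis diff_less zero_less_Suc gr_implies_not0 not_gr_zero)
    moreover have "Suc (k - Suc t) = k - t" using \<open>t < k\<close> by simp
    ultimately show "E (s (k - Suc t)) (g (k - t)) (g (k - Suc t))"
      using E_sym by simp
  qed (use ch in \<open>auto simp: chain_def\<close>)
  moreover have "c = (\<Sum>t<k. (1/2) ^ s (k - Suc t))"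
    unfolding c by (rule sum.nat_diff_reindex[symmetric])
  ultimately show ?thesis using costsI by metis
qed

lemma costs_trans: "c \<in> costs x y \<Longrightarrow> c' \<in> costs y z \<Longrightarrow> c + c' \<in> costs x z"
proof -
  assume "c \<in> costs x y" "c' \<in> costs y z"
  then obtain k s g k' s' g' where
    c: "c = (\<Sum>t<k. (1/2) ^ s t)" "chain k s g x y" and
    c': "c' = (\<Sum>t<k'. (1/2) ^ s' t)" "chain k' s' g' y z"
    by (auto simp: costs_def)
  let ?s = "\<lambda>t. if t < k then s t else s' (t - k)"
  let ?g = "\<lambda>t. if t < k then g t else g' (t - k)"
  have "E (?s t) (?g t) (?g (Suc t))" if "t < k + k'" for t
  proof -
    \<comment> \<open>\<open>Suc t = k\<close> is the seam: there the first chain ends and the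
      second begins, both at \<open>y\<close>.\<close>
    consider "Suc t < k" | "Suc t = k" | "k \<le> t" by linarith
    then show ?thesis
    proof cases
      case 2
      then show ?thesis using c(2) c'(2) unfolding chain_def by force
    next
      case 3
      then have "E (s' (t - k)) (g' (t - k)) (g' (Suc (t - k)))"
        using c'(2) that unfolding chain_def by simp
      with 3 show ?thesis by (simp add: Suc_diff_le)
    qed (use c(2) in \<open>auto simp: chain_def\<close>)
  qed
  moreover have "?g 0 = x" "?g (k + k') = z"
    using c(2) c'(2) unfolding chain_def by auto
  ultimately have "chain (k + k') ?s ?g x z" by (simp add: chain_def)
  moreover have "(\<Sum>t<k + k'. (1/2) ^ ?s t :: real) = c + c'"
  proof -
    have "(\<Sum>t<k + j. f t) = (\<Sum>t<k. f t) + (\<Sum>t<j. f (k + t))" for f :: "nat \<Rightarrow> real" and j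
      by (induction j) simp_all
    then show ?thesis unfolding c(1) c'(1) by simp
  qed
  ultimately show ?thesis using costsI[of "k + k'" ?s ?g x z] by simp
qed

lemma dist_chain_less_iff:
  "x \<in> M \<Longrightarrow> y \<in> M \<Longrightarrow> dist_chain x y < r \<longleftrightarrow> (\<exists>c\<in>costs x y. c < r)"
  unfolding dist_chain_def using cInf_less_iff[OF costs_nonempty bdd_below_costs] by simp

lemma dist_chain_le: "c \<in> costs x y \<Longrightarrow> x \<in> M \<Longrightarrow> y \<in> M \<Longrightarrow> dist_chain x y \<le> c"
  unfolding dist_chain_def using cInf_lower[OF _ bdd_below_costs] by simp

lemma dist_chain_le_if_E: "E n x y \<Longrightarrow> dist_chain x y \<le> (1/2) ^ n"
  using dist_chain_le[OF costs_single] E_carrier E_carrier2 by blast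

text \<open>With \<open>dist_chain_le_if_E\<close> this traps \<open>E n x\<close> between the open
  and the closed ball of radius \<open>(1/2) ^ n\<close> around \<open>x\<close>. Separation and
  topology pass from \<open>E\<close> to the metric through these two bounds.\<close>

lemma E_if_dist_chain_less: "x \<in> M \<Longrightarrow> y \<in> M \<Longrightarrow> dist_chain x y < (1/2) ^ n \<Longrightarrow> E n x y"
proof -
  assume M: "x \<in> M" "y \<in> M" and "dist_chain x y < (1/2) ^ n"
  then obtain k s g where "(\<Sum>t<k. (1/2) ^ s t :: real) < (1/2) ^ n" "chain k s g x y"
    by (auto simp: dist_chain_less_iff costs_def)
  with M(1) chain_short[of 0 k s g n] show ?thesis
    by (simp add: chain_def lessThan_atLeast0)
qed

sublocale Metric_space M dist_chain
proof
  show nonneg: "0 \<le> dist_chain x y" for x y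
    unfolding dist_chain_def using cInf_greatest[OF costs_nonempty costs_nonneg] by auto
  have "costs x y = costs y x" for x y using costs_sym by blast
  then show "dist_chain x y = dist_chain y x" for x y
    unfolding dist_chain_def by simp
  show "dist_chain x y = 0 \<longleftrightarrow> x = y" if "x \<in> M" "y \<in> M" for x y
  proof
    assume "dist_chain x y = 0"
    then show "x = y" using E_separates E_if_dist_chain_less that by simp
  next
    assume "x = y"
    then show "dist_chain x y = 0"
      using dist_chain_le[OF costs_refl] nonneg that by (metis order_antisym)
  qed
  show "dist_chain x z \<le> dist_chain x y + dist_chain y z" if M: "x \<in> M" "y \<in> M" "z \<in> M" for x y z
  proof (rule field_le_epsilon)
    fix e :: real assume "0 < e"
    then obtain c c' where "c \<in> costs x y" "c < dist_chain x y + e / 2"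
        and "c' \<in> costs y z" "c' < dist_chain y z + e / 2"
      using M dist_chain_less_iff[of x y "dist_chain x y + e / 2"]
        dist_chain_less_iff[of y z "dist_chain y z + e / 2"] by auto
    with dist_chain_le[OF costs_trans] M
    show "dist_chain x z \<le> dist_chain x y + dist_chain y z + e" by fastforce
  qed
qed

lemma openin_mtopology_iff_E:
  "openin mtopology U \<longleftrightarrow> U \<subseteq> M \<and> (\<forall>x\<in>U. \<exists>n. \<forall>y. E n x y \<longrightarrow> y \<in> U)"
proof -
  have "(\<exists>r>0. mball x r \<subseteq> U) \<longleftrightarrow> (\<exists>n. \<forall>y. E n x y \<longrightarrow> y \<in> U)" if "x \<in> M" for x
  proof
    assume "\<exists>r>0. mball x r \<subseteq> U"
    then obtain r where r: "r > 0" "mball x r \<subseteq> U" by blast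
    obtain n where "(1/2) ^ n < r" using real_arch_pow_inv[OF r(1), of "1/2"] by auto
    then have "y \<in> mball x r" if "E n x y" for y
      using dist_chain_le_if_E[OF that] E_carrier2[OF that] \<open>x \<in> M\<close> by simp
    with r(2) show "\<exists>n. \<forall>y. E n x y \<longrightarrow> y \<in> U" by blast
  next
    assume "\<exists>n. \<forall>y. E n x y \<longrightarrow> y \<in> U"
    then obtain n where "\<And>y. E n x y \<Longrightarrow> y \<in> U" by blast
    then have "mball x ((1/2) ^ n) \<subseteq> U" using E_if_dist_chain_less by auto
    then show "\<exists>r>0. mball x r \<subseteq> U" by (intro exI[of _ "(1/2) ^ n"]) simp
  qed
  then show ?thesis unfolding openin_mtopology by blast
qed

text \<open>A map respecting every \<open>E n\<close> sends chains to chains with the same levels,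
  hence can only enlarge cost sets; the left inverse \<open>h\<close> gives the opposite
  inclusion.\<close>

lemma dist_chain_invariant:
  assumes "\<And>x. x \<in> M \<Longrightarrow> f x \<in> M" "\<And>x. x \<in> M \<Longrightarrow> h x \<in> M" "\<And>x. x \<in> M \<Longrightarrow> h (f x) = x"
    and "\<And>n x y. E n x y \<Longrightarrow> E n (f x) (f y)" "\<And>n x y. E n x y \<Longrightarrow> E n (h x) (h y)"
    and "x \<in> M" "y \<in> M"
  shows "dist_chain (f x) (f y) = dist_chain x y"
proof -
  have sub: "costs u v \<subseteq> costs (f' u) (f' v)" if "\<And>n x y. E n x y \<Longrightarrow> E n (f' x) (f' y)" for f' u v
  proof
    fix c assume "c \<in> costs u v"
    then obtain k s g where c: "c = (\<Sum>t<k. (1/2) ^ s t)" "chain k s g u v"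
      by (auto simp: costs_def)
    then have "chain k s (\<lambda>t. f' (g t)) (f' u) (f' v)"
      using that by (auto simp: chain_def)
    with c(1) show "c \<in> costs (f' u) (f' v)" unfolding costs_def by blast
  qed
  have "costs (f x) (f y) = costs x y"
    using sub[of f x y] sub[of h "f x" "f y"] assms by auto
  then show ?thesis using assms by (simp add: dist_chain_def)
qed

end

section \<open>Effective neighbourhoods of the unit\<close>

text \<open>On the input \<open>{m}\<close> an enumeration operator can use only axioms whose finite
  set is empty or \<open>{m}\<close>; the canonical indices turn this into an equation between
  numbers.\<close>

lemma set_decode_subset_singleton_iff: "set_decode e \<subseteq> {m} \<longleftrightarrow> e = 0 \<or> e = 2 ^ m"
proof -
  have "set_encode {m} = 2 ^ m" "set_encode {} = 0" by (auto simp: set_encode_def)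
  then have "set_decode e = {} \<longleftrightarrow> e = 0" "set_decode e = {m} \<longleftrightarrow> e = 2 ^ m"
    by (metis set_decode_inverse set_decode_zero, metis set_encode_inverse set_decode_inverse finite.simps)
  then show ?thesis by (simp add: subset_singleton_iff)
qed

text \<open>A basic set has a one-element name, enumerated by a constant sequence. Feeding the
  operator with these names yields one c.e. relation, uniform in \<open>m\<close>.\<close>

lemma effectively_continuous_preimage_base:
  assumes "effectively_continuous X B Y C f" "\<And>m. openin Y (C m)"
  shows "\<exists>R. semidecidable (\<lambda>z. R (cfst z) (csnd z)) \<and>
    (\<forall>m. {x \<in> topspace X. f x \<in> C m} = (\<Union>i\<in>{i. R m i}. B i))"
proof -
  obtain \<Phi> where "enumeration_operator \<Phi>" and
    \<Phi>: "\<And>V p. openin Y V \<Longrightarrow> open_name C V (ran (p :: nat \<Rightarrow> nat option)) \<Longrightarrow>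
      open_name B {x \<in> topspace X. f x \<in> V} (\<Phi> (ran p))"
    using assms(1) unfolding effectively_continuous_def by blast
  then obtain A where "ce A" and A: "\<And>D. \<Phi> D = {n. \<exists>e. prod_encode (n, e) \<in> A \<and> set_decode e \<subseteq> D}"
    unfolding enumeration_operator_def by blast
  define R where "R m i \<longleftrightarrow> (\<exists>e. cpair i e \<in> A \<and> (e = 0 \<or> e = 2 ^ m))" for m i
  have "semidecidable (\<lambda>z. R (cfst z) (csnd z))"
    unfolding R_def
    by (intro semidecidable_intros semidecidable_comp[OF semidecidable_if_ce[OF \<open>ce A\<close>]] computable_intros)
  moreover have "{x \<in> topspace X. f x \<in> C m} = (\<Union>i\<in>{i. R m i}. B i)" for m
  proof -
    have "ran (\<lambda>_::nat. Some m) = {m}" by (auto simp: ran_def)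
    moreover have "\<Phi> {m} = {i. R m i}"
      unfolding A R_def cpair_def set_decode_subset_singleton_iff ..
    ultimately show ?thesis
      using \<Phi>[OF assms(2), of m "\<lambda>_. Some m"] by (simp add: open_name_def)
  qed
  ultimately show ?thesis by blast
qed

context computable_topological_group
begin

lemma mem_base_carrier: "x \<in> B i \<Longrightarrow> x \<in> carrier G"
  using openin_subset[OF base_open] topspace_eq by blast

lemma semidecidable_W: "semidecidable (\<lambda>z. (cfst z, cfst (csnd z), csnd (csnd z)) \<in> W)"
proof -
  let ?c = "\<lambda>(i, j, k). prod_encode (i, prod_encode (j, k))"
  have "z \<in> ?c ` W \<longleftrightarrow> (cfst z, cfst (csnd z), csnd (csnd z)) \<in> W" for z
  proof -
    have "z = ?c w \<longleftrightarrow> w = (cfst z, cfst (csnd z), csnd (csnd z))" for w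
      by (cases w) (metis (no_types, lifting) case_prod_conv cfst_cpair csnd_cpair cpair_cfst_csnd cpair_def)
    then show ?thesis by (auto simp: image_iff)
  qed
  with semidecidable_if_ce[of "?c ` W"] ce_W show ?thesis by (simp add: ce3_def)
qed

lemma base_IntE:
  assumes "x \<in> B i" "x \<in> B j"
  obtains k where "(i, j, k) \<in> W" "x \<in> B k"
  using assms base_Int[of i j] by blast

lemma base_IntD: "(i, j, k) \<in> W \<Longrightarrow> B k \<subseteq> B i \<inter> B j"
  using base_Int[of i j] by blast

text \<open>A triple of \<open>W\<close> certifies an overlap because the set \<open>B k\<close> it
  names is non-empty and lies in both sets.\<close>

lemma base_meet_iff: "B i \<inter> B j \<noteq> {} \<longleftrightarrow> (\<exists>k. (i, j, k) \<in> W)"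
proof -
  have "\<Union>{B k | k. (i, j, k) \<in> W} = {} \<longleftrightarrow> (\<forall>k. (i, j, k) \<notin> W)"
    using base_nonempty by (simp add: Union_empty_conv) metis
  then show ?thesis unfolding base_Int by blast
qed

lemma semidecidable_base_meet: "semidecidable (\<lambda>z. B (cfst z) \<inter> B (csnd z) \<noteq> {})"
  unfolding base_meet_iff
  by (intro semidecidable_intros semidecidable_comp3[OF semidecidable_W] computable_intros)

section \<open>The group operations as relations between basic indices\<close>

lemma mult_relation:
  "\<exists>M. semidecidable (\<lambda>z. M (cfst z) (cfst (csnd z)) (csnd (csnd z))) \<and>
    (\<forall>m. \<forall>x\<in>carrier G. \<forall>y\<in>carrier G. x \<otimes> y \<in> B m \<longleftrightarrow> (\<exists>i j. M m i j \<and> x \<in> B i \<and> y \<in> B j))"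
proof -
  obtain R where R: "semidecidable (\<lambda>z. R (cfst z) (csnd z))"
      "\<And>m. {u \<in> topspace (prod_topology X X). (\<lambda>(x, y). x \<otimes> y) u \<in> B m} = (\<Union>i\<in>{i. R m i}. product_base B B i)"
    using effectively_continuous_preimage_base[OF mult_effective base_open] by blast
  have "semidecidable (\<lambda>z. R (cfst z) (cpair (cfst (csnd z)) (csnd (csnd z))))"
    by (intro semidecidable_comp2[OF R(1)] computable_intros)
  moreover have "x \<otimes> y \<in> B m \<longleftrightarrow> (\<exists>i j. R m (cpair i j) \<and> x \<in> B i \<and> y \<in> B j)"
    if "x \<in> carrier G" "y \<in> carrier G" for m x y
  proof -
    have "x \<otimes> y \<in> B m \<longleftrightarrow> (x, y) \<in> (\<Union>i\<in>{i. R m i}. product_base B B i)"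
      using that topspace_eq unfolding R(2)[symmetric] by simp
    also have "\<dots> \<longleftrightarrow> (\<exists>n. R m n \<and> x \<in> B (cfst n) \<and> y \<in> B (csnd n))"
      by (simp add: product_base_def cfst_def csnd_def case_prod_unfold)
    finally show ?thesis by (metis cfst_cpair csnd_cpair cpair_cfst_csnd)
  qed
  ultimately show ?thesis
    by (intro exI[of _ "\<lambda>m i j. R m (cpair i j)"]) blast
qed

lemma inv_relation:
  "\<exists>I. semidecidable (\<lambda>z. I (cfst z) (csnd z)) \<and>
    (\<forall>m. \<forall>x\<in>carrier G. inv x \<in> B m \<longleftrightarrow> (\<exists>i. I m i \<and> x \<in> B i))"
proof -
  obtain I where I: "semidecidable (\<lambda>z. I (cfst z) (csnd z))"
      "\<And>m. {x \<in> topspace X. inv x \<in> B m} = (\<Union>i\<in>{i. I m i}. B i)"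
    using effectively_continuous_preimage_base[OF inv_effective base_open] by blast
  have "inv x \<in> B m \<longleftrightarrow> (\<exists>i. I m i \<and> x \<in> B i)" if "x \<in> carrier G" for x m
    using that topspace_eq I(2)[of m] by blast
  with I(1) show ?thesis by blast
qed

text \<open>The left invariant quotient serves twice: on the diagonal it detects the unit, off the
  diagonal it describes the steps of chains.\<close>

lemma quotient_relation:
  "\<exists>Q. semidecidable (\<lambda>z. Q (cfst z) (cfst (csnd z)) (csnd (csnd z))) \<and>
    (\<forall>m. \<forall>x\<in>carrier G. \<forall>y\<in>carrier G. inv x \<otimes> y \<in> B m \<longleftrightarrow> (\<exists>i j. Q m i j \<and> x \<in> B i \<and> y \<in> B j))"
proof -
  obtain M where M: "semidecidable (\<lambda>z. M (cfst z) (cfst (csnd z)) (csnd (csnd z)))"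
      "\<And>m x y. x \<in> carrier G \<Longrightarrow> y \<in> carrier G \<Longrightarrow> x \<otimes> y \<in> B m \<longleftrightarrow> (\<exists>i j. M m i j \<and> x \<in> B i \<and> y \<in> B j)"
    using mult_relation by blast
  obtain I where I: "semidecidable (\<lambda>z. I (cfst z) (csnd z))"
      "\<And>m x. x \<in> carrier G \<Longrightarrow> inv x \<in> B m \<longleftrightarrow> (\<exists>i. I m i \<and> x \<in> B i)"
    using inv_relation by blast
  let ?Q = "\<lambda>m i j. \<exists>k. M m k j \<and> I k i"
  have "semidecidable (\<lambda>z. ?Q (cfst z) (cfst (csnd z)) (csnd (csnd z)))"
    by (intro semidecidable_intros semidecidable_comp3[OF M(1)] semidecidable_comp2[OF I(1)] computable_intros)
  moreover have "inv x \<otimes> y \<in> B m \<longleftrightarrow> (\<exists>i j. ?Q m i j \<and> x \<in> B i \<and> y \<in> B j)"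
    if "x \<in> carrier G" "y \<in> carrier G" for m x y
    using M(2)[of "inv x" y m] I(2)[of x] that by auto
  ultimately show ?thesis by (intro exI[of _ ?Q]) blast
qed

text \<open>The unit is a computable point: \<open>\<one> \<in> B m\<close> iff the preimage of \<open>B m\<close> under
  \<open>(x, y) \<mapsto> inv x \<otimes> y\<close> meets the diagonal, which basic rectangles witness.\<close>

lemma semidecidable_one_mem: "semidecidable (\<lambda>m. \<one> \<in> B m)"
proof -
  obtain Q where Q: "semidecidable (\<lambda>z. Q (cfst z) (cfst (csnd z)) (csnd (csnd z)))"
      "\<And>m x y. x \<in> carrier G \<Longrightarrow> y \<in> carrier G \<Longrightarrow>
        inv x \<otimes> y \<in> B m \<longleftrightarrow> (\<exists>i j. Q m i j \<and> x \<in> B i \<and> y \<in> B j)"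
    using quotient_relation by blast
  have "\<one> \<in> B m \<longleftrightarrow> (\<exists>i j. Q m i j \<and> B i \<inter> B j \<noteq> {})" for m
  proof
    assume "\<one> \<in> B m"
    then show "\<exists>i j. Q m i j \<and> B i \<inter> B j \<noteq> {}"
      using Q(2)[of \<one> \<one> m] by auto
  next
    assume "\<exists>i j. Q m i j \<and> B i \<inter> B j \<noteq> {}"
    then obtain i j x where "Q m i j" "x \<in> B i" "x \<in> B j" by blast
    then show "\<one> \<in> B m"
      using Q(2)[of x x m] mem_base_carrier by auto
  qed
  moreover have "semidecidable (\<lambda>m. \<exists>i j. Q m i j \<and> B i \<inter> B j \<noteq> {})"
    by (intro semidecidable_intros semidecidable_comp3[OF Q(1)]
        semidecidable_comp2[OF semidecidable_base_meet] computable_intros)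
  ultimately show ?thesis by simp
qed

text \<open>\<open>M m i j\<close> means that the whole rectangle of \<open>B i\<close> and
  \<open>B j\<close> multiplies into \<open>B m\<close>. So every basic set inside
  \<open>B i \<inter> B j\<close> squares into \<open>B m\<close>, and \<open>W\<close> certifies
  such sets.\<close>

lemma square_step_relation:
  "\<exists>R. semidecidable (\<lambda>z. R (cfst z) (csnd z)) \<and>
    (\<forall>m m'. R m m' \<longrightarrow> \<one> \<in> B m' \<and> (\<forall>x\<in>B m'. \<forall>y\<in>B m'. x \<otimes> y \<in> B m)) \<and>
    (\<forall>m. \<one> \<in> B m \<longrightarrow> (\<exists>m'. R m m'))"
proof -
  obtain M where M: "semidecidable (\<lambda>z. M (cfst z) (cfst (csnd z)) (csnd (csnd z)))"
      "\<And>m x y. x \<in> carrier G \<Longrightarrow> y \<in> carrier G \<Longrightarrow> x \<otimes> y \<in> B m \<longleftrightarrow> (\<exists>i j. M m i j \<and> x \<in> B i \<and> y \<in> B j)"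
    using mult_relation by blast
  let ?R = "\<lambda>m m'. \<one> \<in> B m' \<and> (\<exists>i j. M m i j \<and> (i, j, m') \<in> W)"
  have "semidecidable (\<lambda>z. ?R (cfst z) (csnd z))"
    by (intro semidecidable_intros semidecidable_comp3[OF M(1)] semidecidable_comp3[OF semidecidable_W]
        semidecidable_comp[OF semidecidable_one_mem] computable_intros)
  moreover have "x \<otimes> y \<in> B m" if "?R m m'" "x \<in> B m'" "y \<in> B m'" for m m' x y
    using that M(2)[of x y m] base_IntD mem_base_carrier by blast
  moreover have "\<exists>m'. ?R m m'" if one: "\<one> \<in> B m" for m
  proof -
    have "\<one> \<otimes> \<one> \<in> B m" using one by simp
    then obtain i j where "M m i j" "\<one> \<in> B i" "\<one> \<in> B j"
      using M(2)[of \<one> \<one> m] by blast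
    then show ?thesis using base_IntE by metis
  qed
  ultimately show ?thesis by (intro exI[of _ ?R]) blast
qed

lemma inverse_step_relation:
  "\<exists>R. semidecidable (\<lambda>z. R (cfst z) (csnd z)) \<and>
    (\<forall>m m'. R m m' \<longrightarrow> \<one> \<in> B m' \<and> (\<forall>x\<in>B m'. x \<in> B m \<and> inv x \<in> B m)) \<and>
    (\<forall>m. \<one> \<in> B m \<longrightarrow> (\<exists>m'. R m m'))"
proof -
  obtain I where I: "semidecidable (\<lambda>z. I (cfst z) (csnd z))"
      "\<And>m x. x \<in> carrier G \<Longrightarrow> inv x \<in> B m \<longleftrightarrow> (\<exists>i. I m i \<and> x \<in> B i)"
    using inv_relation by blast
  let ?R = "\<lambda>m m'. \<one> \<in> B m' \<and> (\<exists>i. I m i \<and> (m, i, m') \<in> W)"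
  have "semidecidable (\<lambda>z. ?R (cfst z) (csnd z))"
    by (intro semidecidable_intros semidecidable_comp2[OF I(1)] semidecidable_comp3[OF semidecidable_W]
        semidecidable_comp[OF semidecidable_one_mem] computable_intros)
  moreover have "x \<in> B m \<and> inv x \<in> B m" if "?R m m'" "x \<in> B m'" for m m' x
    using that I(2)[of x m] base_IntD mem_base_carrier by blast
  moreover have "\<exists>m'. ?R m m'" if one: "\<one> \<in> B m" for m
  proof -
    have "inv \<one> \<in> B m" using one by simp
    then obtain i where "I m i" "\<one> \<in> B i"
      using I(2)[of \<one> m] by blast
    then show ?thesis using base_IntE one by metis
  qed
  ultimately show ?thesis by (intro exI[of _ ?R]) blast
qed

text \<open>With the union, a symmetric step is a disjunction: \<open>inv x \<otimes> y\<close> or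
  \<open>inv y \<otimes> x\<close> lies in \<open>B m\<close>. Hence it is covered by the rectangles
  of the quotient relation, read in either order.\<close>

definition sym_base :: "nat \<Rightarrow> 'a set" where
  "sym_base m = {x \<in> carrier G. x \<in> B m \<or> inv x \<in> B m}"

text \<open>Two squarings control a fourfold product; one factor is spent on the unit, which puts
  \<open>z\<close> into the same set as \<open>x \<otimes> y\<close>. The inverse step comes last
  and absorbs the symmetrisation. The parameter \<open>b\<close> prescribes a second target, through
  which the sequence will be forced to shrink to the unit.\<close>

lemma cube_step_relation:
  "\<exists>R. semidecidable (\<lambda>z. R (cfst z) (cfst (csnd z)) (csnd (csnd z))) \<and>
    (\<forall>m b m'. R m b m' \<longrightarrow> \<one> \<in> B m' \<and>
      (\<forall>x\<in>sym_base m'. \<forall>y\<in>sym_base m'. \<forall>z\<in>sym_base m'. x \<otimes> y \<otimes> z \<in> B m \<inter> B b)) \<and>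
    (\<forall>m b. \<one> \<in> B m \<longrightarrow> \<one> \<in> B b \<longrightarrow> (\<exists>m'. R m b m'))"
proof -
  obtain S where S: "semidecidable (\<lambda>z. S (cfst z) (csnd z))"
      "\<And>m m'. S m m' \<Longrightarrow> \<one> \<in> B m'" "\<And>m m' x y. S m m' \<Longrightarrow> x \<in> B m' \<Longrightarrow> y \<in> B m' \<Longrightarrow> x \<otimes> y \<in> B m"
      "\<And>m. \<one> \<in> B m \<Longrightarrow> \<exists>m'. S m m'"
    using square_step_relation by blast
  obtain V where V: "semidecidable (\<lambda>z. V (cfst z) (csnd z))"
      "\<And>m m'. V m m' \<Longrightarrow> \<one> \<in> B m'" "\<And>m m' x. V m m' \<Longrightarrow> x \<in> B m' \<Longrightarrow> x \<in> B m \<and> inv x \<in> B m"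
      "\<And>m. \<one> \<in> B m \<Longrightarrow> \<exists>m'. V m m'"
    using inverse_step_relation by blast
  let ?R = "\<lambda>m b m'. \<exists>k1 k2 k3. (m, b, k1) \<in> W \<and> S k1 k2 \<and> S k2 k3 \<and> V k3 m'"
  have "semidecidable (\<lambda>z. ?R (cfst z) (cfst (csnd z)) (csnd (csnd z)))"
    by (intro semidecidable_intros semidecidable_comp2[OF S(1)] semidecidable_comp2[OF V(1)]
        semidecidable_comp3[OF semidecidable_W] computable_intros)
  moreover have "x \<otimes> y \<otimes> z \<in> B m \<inter> B b"
    if R: "?R m b m'" and xyz: "x \<in> sym_base m'" "y \<in> sym_base m'" "z \<in> sym_base m'" for m b m' x y z
  proof -
    obtain k1 k2 k3 where k: "(m, b, k1) \<in> W" "S k1 k2" "S k2 k3" "V k3 m'"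
      using R by blast
    have "u \<in> B k3" if "u \<in> sym_base m'" for u
      using that V(3)[OF k(4), of u] V(3)[OF k(4), of "inv u"] by (auto simp: sym_base_def)
    with xyz have "x \<in> B k3" "y \<in> B k3" "z \<in> B k3" by auto
    moreover from this(3) have "\<one> \<otimes> z \<in> B k2"
      using S(2)[OF k(3)] S(3)[OF k(3)] by blast
    moreover have "\<one> \<in> B k3" using S(2)[OF k(3)] .
    ultimately have "x \<otimes> y \<in> B k2" "z \<in> B k2"
      using S(3)[OF k(3)] mem_base_carrier by auto
    then have "x \<otimes> y \<otimes> z \<in> B k1" using S(3)[OF k(2)] by blast
    with base_IntD[OF k(1)] show ?thesis by blast
  qed
  moreover have "\<one> \<in> B m'" if "?R m b m'" for m b m' using that V(2) by blast
  moreover have "\<exists>m'. ?R m b m'" if "\<one> \<in> B m" "\<one> \<in> B b" for m b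
    using base_IntE[OF that] S(2,4) V(4) by metis
  ultimately show ?thesis by (intro exI[of _ ?R]) blast
qed

lemma one_in_base: "\<exists>m. \<one> \<in> B m"
  using base[OF openin_topspace, of \<one>] topspace_eq by auto

text \<open>Uniformization needs a total relation, so the search runs over an enumeration \<open>\<beta>\<close> of the
  basic neighbourhoods of the unit.\<close>

lemma computable_neighbourhood_sequence:
  "\<exists>\<mu>. computable \<mu> \<and> (\<forall>n. \<one> \<in> B (\<mu> n)) \<and>
    (\<forall>n. \<forall>x\<in>sym_base (\<mu> (Suc n)). \<forall>y\<in>sym_base (\<mu> (Suc n)). \<forall>z\<in>sym_base (\<mu> (Suc n)).
      x \<otimes> y \<otimes> z \<in> B (\<mu> n)) \<and>
    (\<forall>b. \<one> \<in> B b \<longrightarrow> (\<exists>n. sym_base (\<mu> n) \<subseteq> B b))"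
proof -
  have "ce {m. \<one> \<in> B m}" by (rule ce_if_semidecidable[OF semidecidable_one_mem])
  then obtain \<beta> where \<beta>: "computable \<beta>" "{m. \<one> \<in> B m} = range \<beta>"
    using one_in_base unfolding ce_def by blast
  then have one_\<beta>: "\<one> \<in> B (\<beta> n)" for n by blast
  obtain R where R: "semidecidable (\<lambda>z. R (cfst z) (cfst (csnd z)) (csnd (csnd z)))"
      "\<And>m b m'. R m b m' \<Longrightarrow> \<one> \<in> B m'"
      "\<And>m b m' x y z. R m b m' \<Longrightarrow> x \<in> sym_base m' \<Longrightarrow> y \<in> sym_base m' \<Longrightarrow> z \<in> sym_base m' \<Longrightarrow>
        x \<otimes> y \<otimes> z \<in> B m \<inter> B b"
      "\<And>m b. \<one> \<in> B m \<Longrightarrow> \<one> \<in> B b \<Longrightarrow> \<exists>m'. R m b m'"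
    using cube_step_relation by blast
  let ?P = "\<lambda>u t. R (\<beta> (cfst u)) (\<beta> (csnd u)) (\<beta> t)"
  have "semidecidable (\<lambda>z. ?P (cfst z) (csnd z))"
    by (intro semidecidable_comp3[OF R(1)] computable_comp[OF \<beta>(1)] computable_intros)
  moreover have "\<exists>t. ?P u t" for u
  proof -
    obtain m' where m': "R (\<beta> (cfst u)) (\<beta> (csnd u)) m'" using R(4)[OF one_\<beta> one_\<beta>] by blast
    then have "m' \<in> range \<beta>" using R(2) \<beta>(2) by blast
    with m' show ?thesis by blast
  qed
  ultimately obtain f where f: "computable f" "\<And>u. ?P u (f u)"
    using semidecidable_uniformization[of ?P] by blast
  \<comment> \<open>The state \<open>s n\<close> is a position in \<open>\<beta>\<close>. Stage
    \<open>n\<close> also demands cubes inside \<open>B (\<beta> n)\<close>, so each basic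
    neighbourhood of the unit is served at some stage.\<close>
  define s where "s n = rec_nat 0 (\<lambda>k r. f (cpair r k)) n" for n
  define \<mu> where "\<mu> n = \<beta> (s n)" for n
  have "computable s"
    unfolding s_def by (intro computable_intros computable_comp[OF f(1)])
  then have "computable \<mu>"
    unfolding \<mu>_def by (rule computable_comp[OF \<beta>(1)])
  moreover have "\<one> \<in> B (\<mu> n)" for n using one_\<beta> by (simp add: \<mu>_def)
  moreover have step: "R (\<mu> n) (\<beta> n) (\<mu> (Suc n))" for n
    using f(2)[of "cpair (s n) n"] by (simp add: \<mu>_def s_def)
  moreover have "\<exists>n. sym_base (\<mu> n) \<subseteq> B b" if b: "\<one> \<in> B b" for b
  proof -
    obtain n where n: "b = \<beta> n" using \<beta>(2) b by blast
    have "x \<in> B b" if x: "x \<in> sym_base (\<mu> (Suc n))" for x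
    proof -
      \<comment> \<open>Padding with two units turns the bound on cubes into a bound on
        \<open>x\<close> itself.\<close>
      have "\<one> \<in> sym_base (\<mu> (Suc n))" using R(2)[OF step] by (simp add: sym_base_def)
      then have "x \<otimes> \<one> \<otimes> \<one> \<in> B b" using R(3)[OF step, of x n \<one> \<one>] x n by blast
      then show ?thesis using x by (simp add: sym_base_def)
    qed
    then show ?thesis by blast
  qed
  ultimately show ?thesis
    using R(3)[OF step] by (intro exI[of _ \<mu>]) blast
qed

end

section \<open>Enumerating the right cut of the chain metric\<close>

text \<open>A code of a chain from \<open>B a\<close> to \<open>B b\<close> of cost below \<open>p / q\<close>: step \<open>t\<close> of the \<open>Suc K\<close> steps has
  level \<open>seq_nth u t\<close> and leads from the basic set \<open>seq_nth v t\<close> to \<open>seq_nth w t\<close>; consecutive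
  steps can be joined at a common point of the basic sets. The common denominator \<open>2 ^ N\<close> keeps
  the cost condition inside the natural numbers.\<close>

definition chain_code ::
  "(nat \<Rightarrow> 'a set) \<Rightarrow> (nat \<Rightarrow> nat \<Rightarrow> nat \<Rightarrow> bool) \<Rightarrow> nat \<Rightarrow> nat \<Rightarrow> nat \<Rightarrow> nat \<Rightarrow> bool" where
  "chain_code B S p q a b \<longleftrightarrow> (\<exists>K N u v w.
    a = seq_nth v 0 \<and> b = seq_nth w K \<and>
    (\<forall>t<Suc K. seq_nth u t \<le> N \<and> S (seq_nth u t) (seq_nth v t) (seq_nth w t)) \<and>
    (\<forall>t<K. B (seq_nth w t) \<inter> B (seq_nth v (Suc t)) \<noteq> {}) \<and>
    q * (\<Sum>t<Suc K. 2 ^ (N - seq_nth u t)) < p * 2 ^ N)"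

lemma semidecidable_chain_code:
  assumes "semidecidable (\<lambda>z. S (cfst z) (cfst (csnd z)) (csnd (csnd z)))"
    and "semidecidable (\<lambda>z. B (cfst z) \<inter> B (csnd z) \<noteq> {})"
    and "computable p" "computable q" "computable a" "computable b"
  shows "semidecidable (\<lambda>x. chain_code B S (p x) (q x) (a x) (b x))"
  unfolding chain_code_def
  by (intro semidecidable_intros semidecidable_comp3[OF assms(1)] semidecidable_comp2[OF assms(2)]
      computable_comp[OF assms(3)] computable_comp[OF assms(4)] computable_comp[OF assms(5)]
      computable_comp[OF assms(6)] computable_intros)

lemma cost_less_iff:
  fixes s :: "nat \<Rightarrow> nat"
  assumes "\<And>t. t < k \<Longrightarrow> s t \<le> N" "0 < q"
  shows "(\<Sum>t<k. (1/2) ^ s t) < real p / real q \<longleftrightarrow> q * (\<Sum>t<k. 2 ^ (N - s t)) < p * 2 ^ N"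
proof -
  have "(1/2) ^ s t = 2 ^ (N - s t) / (2 ^ N :: real)" if "t < k" for t
    using assms(1)[OF that] by (simp add: power_diff power_one_over field_simps)
  then have "(\<Sum>t<k. (1/2) ^ s t) = (\<Sum>t<k. 2 ^ (N - s t)) / (2 ^ N :: real)"
    by (simp add: sum_divide_distrib)
  also have "\<dots> < real p / real q \<longleftrightarrow> real q * (\<Sum>t<k. 2 ^ (N - s t)) < real p * 2 ^ N"
    using assms(2) by (simp add: field_simps)
  also have "\<dots> \<longleftrightarrow> real (q * (\<Sum>t<k. 2 ^ (N - s t))) < real (p * 2 ^ N)"
    by simp
  finally show ?thesis by (simp only: of_nat_less_iff)
qed

text \<open>A code needs a basic set around each end point, which the empty chain does not supply.
  It is replaced by one reflexive step of a level so high that the cost stays below the strict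
  bound.\<close>

lemma (in entourage_sequence) dist_chain_less_iff_chain:
  assumes "x \<in> M" "y \<in> M"
  shows "dist_chain x y < r \<longleftrightarrow> (\<exists>K s g. chain (Suc K) s g x y \<and> (\<Sum>t<Suc K. (1/2) ^ s t) < r)"
proof
  assume "dist_chain x y < r"
  then obtain k s g where ch: "chain k s g x y" "(\<Sum>t<k. (1/2) ^ s t) < r"
    using assms by (auto simp: dist_chain_less_iff costs_def)
  show "\<exists>K s g. chain (Suc K) s g x y \<and> (\<Sum>t<Suc K. (1/2) ^ s t) < r"
  proof (cases k)
    case 0
    with ch have "x = y" "0 < r" by (auto simp: chain_def)
    then obtain n where "(1/2) ^ n < r" using real_arch_pow_inv[of r "1/2"] by auto
    then have "chain (Suc 0) (\<lambda>_. n) (\<lambda>_. x) x y \<and> (\<Sum>t<Suc 0. (1/2) ^ n) < r"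
      using \<open>x = y\<close> E_refl assms by (simp add: chain_def)
    then show ?thesis by blast
  next
    case (Suc K)
    with ch show ?thesis by blast
  qed
next
  assume "\<exists>K s g. chain (Suc K) s g x y \<and> (\<Sum>t<Suc K. (1/2) ^ s t) < r"
  then show "dist_chain x y < r"
    using costsI dist_chain_less_iff[OF assms] by blast
qed

text \<open>Rectangles can be chosen along a given chain. Conversely, overlaps supply intermediate
  points, and the end points may be any points of the outer sets; so a code refers to
  \<open>x\<close> and \<open>y\<close> only through \<open>a\<close> and \<open>b\<close>.\<close>

lemma (in entourage_sequence) dist_chain_less_iff_code:
  assumes E_iff: "\<And>n x y. E n x y \<longleftrightarrow> (\<exists>i j. S n i j \<and> x \<in> B i \<and> y \<in> B j)"
    and M: "x \<in> M" "y \<in> M" and "0 < q"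
  shows "dist_chain x y < real p / real q \<longleftrightarrow> (\<exists>a b. x \<in> B a \<and> y \<in> B b \<and> chain_code B S p q a b)"
proof
  assume "dist_chain x y < real p / real q"
  then obtain K s g where ch: "chain (Suc K) s g x y" and cost: "(\<Sum>t<Suc K. (1/2) ^ s t) < real p / real q"
    using dist_chain_less_iff_chain[OF M] by blast
  have "\<exists>i j. S (s t) i j \<and> g t \<in> B i \<and> g (Suc t) \<in> B j" if "t < Suc K" for t
    using ch that E_iff unfolding chain_def by blast
  then obtain i j where ij: "\<And>t. t < Suc K \<Longrightarrow> S (s t) (i t) (j t) \<and> g t \<in> B (i t) \<and> g (Suc t) \<in> B (j t)"
    by metis
  obtain u where u: "\<forall>t<Suc K. seq_nth u t = s t" using seq_nth_exists by blast
  obtain v where v: "\<forall>t<Suc K. seq_nth v t = i t" using seq_nth_exists by blast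
  obtain w where w: "\<forall>t<Suc K. seq_nth w t = j t" using seq_nth_exists by blast
  \<comment> \<open>Any common upper bound of the levels would do as exponent of the
    denominator.\<close>
  define N where "N = (\<Sum>t<Suc K. s t)"
  have N: "s t \<le> N" if "t < Suc K" for t
    unfolding N_def using that by (intro member_le_sum) auto
  have "q * (\<Sum>t<Suc K. 2 ^ (N - s t)) < p * 2 ^ N"
    using cost cost_less_iff[of "Suc K" s N q p] N \<open>0 < q\<close> by blast
  moreover have "(\<Sum>t<Suc K. 2 ^ (N - seq_nth u t)) = (\<Sum>t<Suc K. 2 ^ (N - s t) :: nat)"
    using u by (intro sum.cong) auto
  moreover have "B (seq_nth w t) \<inter> B (seq_nth v (Suc t)) \<noteq> {}" if "t < K" for t
    using ij[of t] ij[of "Suc t"] v w that by auto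
  ultimately have "chain_code B S p q (i 0) (j K)"
    unfolding chain_code_def using u v w N ij
    by (intro exI[of _ K] exI[of _ N] exI[of _ u] exI[of _ v] exI[of _ w]) simp
  moreover have "x \<in> B (i 0)" "y \<in> B (j K)"
    using ch ij[of 0] ij[of K] by (auto simp: chain_def)
  ultimately show "\<exists>a b. x \<in> B a \<and> y \<in> B b \<and> chain_code B S p q a b" by blast
next
  assume "\<exists>a b. x \<in> B a \<and> y \<in> B b \<and> chain_code B S p q a b"
  then obtain K N u v w where xy: "x \<in> B (seq_nth v 0)" "y \<in> B (seq_nth w K)"
    and step: "\<And>t. t < Suc K \<Longrightarrow> seq_nth u t \<le> N \<and> S (seq_nth u t) (seq_nth v t) (seq_nth w t)"
    and meet: "\<And>t. t < K \<Longrightarrow> B (seq_nth w t) \<inter> B (seq_nth v (Suc t)) \<noteq> {}"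
    and cost: "q * (\<Sum>t<Suc K. 2 ^ (N - seq_nth u t)) < p * 2 ^ N"
    unfolding chain_code_def by metis
  have "\<exists>c. c \<in> B (seq_nth w t) \<and> c \<in> B (seq_nth v (Suc t))" if "t < K" for t
    using meet[OF that] by blast
  then obtain h where h: "\<And>t. t < K \<Longrightarrow> h t \<in> B (seq_nth w t) \<and> h t \<in> B (seq_nth v (Suc t))"
    by metis
  \<comment> \<open>The index shifts by one: \<open>h (t - 1)\<close> is the point where step
    \<open>t - 1\<close> arrives and step \<open>t\<close> departs.\<close>
  define g where "g t = (if t = 0 then x else if t \<le> K then h (t - 1) else y)" for t
  have left: "g t \<in> B (seq_nth v t)" if "t < Suc K" for t
    using that xy(1) h[of "t - 1"] by (cases t) (auto simp: g_def)
  have right: "g (Suc t) \<in> B (seq_nth w t)" if "t < Suc K" for t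
    using that xy(2) h[of t] by (cases "t = K") (auto simp: g_def)
  have "E (seq_nth u t) (g t) (g (Suc t))" if "t < Suc K" for t
    using E_iff step[OF that] left[OF that] right[OF that] by blast
  then have "chain (Suc K) (seq_nth u) g x y"
    by (simp add: chain_def g_def)
  moreover have "(\<Sum>t<Suc K. (1/2) ^ seq_nth u t) < real p / real q"
    using cost cost_less_iff[of "Suc K" "seq_nth u" N q p] step \<open>0 < q\<close> by blast
  ultimately show "dist_chain x y < real p / real q"
    using dist_chain_less_iff_chain[OF M] by blast
qed

section \<open>Codings of the input names and of the output rationals\<close>

lemma mem_ran_enum_join:
  "2 * a \<in> ran (enum_join p q) \<longleftrightarrow> a \<in> ran p"
  "2 * b + 1 \<in> ran (enum_join p q) \<longleftrightarrow> b \<in> ran q"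
proof -
  have double: "2 * a \<noteq> Suc (2 * b)" for a b :: nat by presburger
  have "enum_join p q (2 * n) = Some (2 * a)" if "p n = Some a" for n a
    using that by (simp add: enum_join_def)
  moreover have "\<exists>n. p n = Some a" if "enum_join p q n = Some (2 * a)" for n a
    using that double[of a, symmetric] by (auto simp: enum_join_def split: if_splits)
  ultimately show "2 * a \<in> ran (enum_join p q) \<longleftrightarrow> a \<in> ran p"
    unfolding ran_def by blast
  have "enum_join p q (2 * n + 1) = Some (2 * b + 1)" if "q n = Some b" for n b
    using that by (simp add: enum_join_def)
  moreover have "\<exists>n. q n = Some b" if "enum_join p q n = Some (2 * b + 1)" for n b
    using that double[of _ b] by (auto simp: enum_join_def split: if_splits)
  ultimately show "2 * b + 1 \<in> ran (enum_join p q) \<longleftrightarrow> b \<in> ran q"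
    unfolding ran_def by blast
qed

text \<open>An axiom of the final operator asks for one basic index of each point; this is the
  canonical index of that demand on the join.\<close>

lemma set_decode_join: "set_decode (2 ^ (2 * a) + 2 ^ (2 * b + 1)) = {2 * a, 2 * b + 1}"
proof -
  have "2 * a \<noteq> 2 * b + 1" by presburger
  then have "set_encode {2 * a, 2 * b + 1} = 2 ^ (2 * a) + 2 ^ (2 * b + 1)" by simp
  then show ?thesis by (metis set_encode_inverse finite.emptyI finite_insert)
qed

text \<open>\<open>int_decode\<close> maps even numbers to the non-negative integers, so doubling
  encodes a natural number as an integer.\<close>

lemma nat_to_rat_surj_double: "nat_to_rat_surj (cpair (2 * p) (2 * q)) = Fract (int p) (int q)"
  by (simp add: nat_to_rat_surj_def cpair_def int_decode_def sum_decode_def)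

text \<open>Only positive rationals, in the presentation \<open>Fract p q\<close> with natural numbers \<open>p\<close> and \<open>q > 0\<close>,
  are ever enumerated.\<close>

lemma right_cut_operator:
  assumes "semidecidable (\<lambda>z. L (cfst z) (cfst (csnd z)) (cfst (csnd (csnd z))) (csnd (csnd (csnd z))))"
  shows "\<exists>\<Phi>. enumeration_operator \<Phi> \<and> (\<forall>p q (\<delta> :: real).
    0 \<le> \<delta> \<longrightarrow>
    (\<forall>k l. 0 < l \<longrightarrow> (\<delta> < real k / real l \<longleftrightarrow> (\<exists>a b. a \<in> ran p \<and> b \<in> ran q \<and> L k l a b))) \<longrightarrow>
    nat_to_rat_surj ` \<Phi> (ran (enum_join p q)) = {r. \<delta> < of_rat r})"
proof -
  \<comment> \<open>Other codes of the same rational are never output, which is harmless because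
    only the image under \<open>nat_to_rat_surj\<close> counts.\<close>
  let ?P = "\<lambda>z. \<exists>k l a b. z = cpair (cpair (2 * k) (2 * l)) (2 ^ (2 * a) + 2 ^ (2 * b + 1)) \<and> 0 < l \<and> L k l a b"
  define \<Phi> where "\<Phi> A = {n. \<exists>e. prod_encode (n, e) \<in> {z. ?P z} \<and> set_decode e \<subseteq> A}" for A
  have L: "semidecidable (\<lambda>x. L (f x) (g x) (h x) (i x))"
    if "computable f" "computable g" "computable h" "computable i" for f g h i
    using semidecidable_comp[OF assms, of "\<lambda>x. cpair (f x) (cpair (g x) (cpair (h x) (i x)))"] that
    by (simp add: computable_intros)
  have "semidecidable ?P"
    by (intro semidecidable_intros L computable_intros)
  then have "enumeration_operator \<Phi>"
    unfolding enumeration_operator_def \<Phi>_def using ce_if_semidecidable by blast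
  moreover have "nat_to_rat_surj ` \<Phi> (ran (enum_join p q)) = {r. \<delta> < of_rat r}"
    if "0 \<le> \<delta>" and
      cut: "\<And>k l. 0 < l \<Longrightarrow> \<delta> < real k / real l \<longleftrightarrow> (\<exists>a b. a \<in> ran p \<and> b \<in> ran q \<and> L k l a b)"
    for p q and \<delta> :: real
  proof -
    have mem: "n \<in> \<Phi> (ran (enum_join p q)) \<longleftrightarrow>
        (\<exists>k l. n = cpair (2 * k) (2 * l) \<and> 0 < l \<and> \<delta> < real k / real l)" for n
    proof -
      have "n \<in> \<Phi> (ran (enum_join p q)) \<longleftrightarrow> (\<exists>k l a b. n = cpair (2 * k) (2 * l) \<and> 0 < l \<and> L k l a b \<and>
          set_decode (2 ^ (2 * a) + 2 ^ (2 * b + 1)) \<subseteq> ran (enum_join p q))"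
        unfolding \<Phi>_def mem_Collect_eq cpair_def prod_encode_eq prod.inject by blast
      also have "\<dots> \<longleftrightarrow> (\<exists>k l. n = cpair (2 * k) (2 * l) \<and> 0 < l \<and> (\<exists>a b. a \<in> ran p \<and> b \<in> ran q \<and> L k l a b))"
        unfolding set_decode_join insert_subset mem_ran_enum_join by blast
      finally show ?thesis using cut by blast
    qed
    show ?thesis
    proof (intro equalityI subsetI)
      fix r assume "r \<in> nat_to_rat_surj ` \<Phi> (ran (enum_join p q))"
      then obtain k l where "r = Fract (int k) (int l)" "0 < l" "\<delta> < real k / real l"
        unfolding image_iff Bex_def mem using nat_to_rat_surj_double by metis
      then show "r \<in> {r. \<delta> < of_rat r}" by (simp add: of_rat_rat)
    next
      fix r assume "r \<in> {r. \<delta> < of_rat r}"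
      then have r: "\<delta> < of_rat r" by simp
      obtain k l :: int where kl: "r = Fract k l" "0 < l" by (cases r) auto
      have "0 < (of_rat r :: real)" using r \<open>0 \<le> \<delta>\<close> by linarith
      then have "0 < r" by simp
      then have "0 < k" using kl by (simp add: zero_less_Fract_iff)
      then have "r = Fract (int (nat k)) (int (nat l))" "0 < nat l" using kl by auto
      moreover from this have "\<delta> < real (nat k) / real (nat l)"
        using r kl \<open>0 < k\<close> by (simp add: of_rat_rat)
      ultimately show "r \<in> nat_to_rat_surj ` \<Phi> (ran (enum_join p q))"
        unfolding image_iff Bex_def mem using nat_to_rat_surj_double by metis
    qed
  qed
  ultimately show ?thesis by blast
qed

theorem theorem3p2:
  fixes G :: "('a, 'b) monoid_scheme" (structure)
    and X :: "'a topology" and B :: "nat \<Rightarrow> 'a set" and W :: "(nat \<times> nat \<times> nat) set"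
  assumes "computable_topological_group G X B W"
  shows "\<exists>d :: 'a \<Rightarrow> 'a \<Rightarrow> real.
    Metric_space (carrier G) d \<and>
    Metric_space.mtopology (carrier G) d = X \<and>
    (\<forall>g\<in>carrier G. \<forall>x\<in>carrier G. \<forall>y\<in>carrier G. d (g \<otimes> x) (g \<otimes> y) = d x y) \<and>
    (\<exists>\<Phi>. enumeration_operator \<Phi> \<and>
      (\<forall>y\<in>carrier G. \<forall>z\<in>carrier G. \<forall>p q.
        ran p = point_name B y \<longrightarrow> ran q = point_name B z \<longrightarrow>
        nat_to_rat_surj ` \<Phi> (ran (enum_join p q)) = {r :: rat. d y z < of_rat r}))"
proof -
  interpret computable_topological_group G X B W by fact
  obtain \<mu> where \<mu>: "computable \<mu>" "\<And>n. \<one> \<in> B (\<mu> n)"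
      "\<And>n x y z. x \<in> sym_base (\<mu> (Suc n)) \<Longrightarrow> y \<in> sym_base (\<mu> (Suc n)) \<Longrightarrow> z \<in> sym_base (\<mu> (Suc n)) \<Longrightarrow>
        x \<otimes> y \<otimes> z \<in> B (\<mu> n)"
      "\<And>b. \<one> \<in> B b \<Longrightarrow> \<exists>n. sym_base (\<mu> n) \<subseteq> B b"
    using computable_neighbourhood_sequence by blast
  obtain Q where Q: "semidecidable (\<lambda>z. Q (cfst z) (cfst (csnd z)) (csnd (csnd z)))"
      "\<And>m x y. x \<in> carrier G \<Longrightarrow> y \<in> carrier G \<Longrightarrow>
        inv x \<otimes> y \<in> B m \<longleftrightarrow> (\<exists>i j. Q m i j \<and> x \<in> B i \<and> y \<in> B j)"
    using quotient_relation by blast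
  \<comment> \<open>Level 0 is total, so the neighbourhood \<open>\<mu> n\<close> sits at level
    \<open>n + 1\<close>, in accordance with its cost \<open>(1/2) ^ (n + 1)\<close>.\<close>
  define E where "E n x y \<longleftrightarrow> x \<in> carrier G \<and> y \<in> carrier G \<and>
    (n = 0 \<or> inv x \<otimes> y \<in> sym_base (\<mu> (n - 1)))" for n x y
  define S where "S n i j \<longleftrightarrow> n = 0 \<or> Q (\<mu> (n - 1)) i j \<or> Q (\<mu> (n - 1)) j i" for n i j
  have inv_quot: "inv (inv x \<otimes> y) = inv y \<otimes> x" if "x \<in> carrier G" "y \<in> carrier G" for x y
    using that by (simp add: inv_mult_group)
  have mem_B: "\<exists>i. x \<in> B i" if "x \<in> carrier G" for x
    using base[OF openin_topspace] topspace_eq that by blast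
  have E_iff: "E n x y \<longleftrightarrow> (\<exists>i j. S n i j \<and> x \<in> B i \<and> y \<in> B j)" for n x y
  proof (cases "x \<in> carrier G \<and> y \<in> carrier G")
    case True
    then show ?thesis
      using Q(2)[of x y "\<mu> (n - 1)"] Q(2)[of y x "\<mu> (n - 1)"] mem_B[of x] mem_B[of y] inv_quot[of x y]
      unfolding E_def S_def sym_base_def by auto
  next
    case False
    then show ?thesis using mem_base_carrier by (auto simp: E_def)
  qed
  have semi_S: "semidecidable (\<lambda>z. S (cfst z) (cfst (csnd z)) (csnd (csnd z)))"
    unfolding S_def
    by (intro semidecidable_intros semidecidable_comp3[OF Q(1)] computable_comp[OF \<mu>(1)] computable_intros)
  have nbhd: "\<exists>n. \<forall>y. E n x y \<longrightarrow> y \<in> U" if "openin X U" "x \<in> U" for U x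
  proof -
    have x: "x \<in> carrier G" using openin_subset[OF that(1)] that(2) topspace_eq by blast
    obtain m where m: "x \<in> B m" "B m \<subseteq> U" using base[OF \<open>openin X U\<close> \<open>x \<in> U\<close>] by blast
    obtain M where M: "\<And>m x y. x \<in> carrier G \<Longrightarrow> y \<in> carrier G \<Longrightarrow>
        x \<otimes> y \<in> B m \<longleftrightarrow> (\<exists>i j. M m i j \<and> x \<in> B i \<and> y \<in> B j)"
      using mult_relation by blast
    \<comment> \<open>Continuity of multiplication at \<open>(x, \<one>)\<close> gives a
      neighbourhood \<open>B j\<close> of the unit whose left translate by \<open>x\<close> stays in
      \<open>B m\<close>.\<close>
    have "x \<otimes> \<one> \<in> B m" using m x by simp
    then obtain i j where ij: "M m i j" "x \<in> B i" "\<one> \<in> B j" using M[OF x one_closed] by blast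
    obtain n where n: "sym_base (\<mu> n) \<subseteq> B j" using \<mu>(4)[OF ij(3)] by blast
    have "y \<in> U" if "E (Suc n) x y" for y
    proof -
      have y: "y \<in> carrier G" "inv x \<otimes> y \<in> B j" using that n by (auto simp: E_def)
      then have "x \<otimes> (inv x \<otimes> y) \<in> B m" using M[of x "inv x \<otimes> y" m] ij x by blast
      then show ?thesis using m x y by (auto simp: m_assoc[symmetric])
    qed
    then show ?thesis by blast
  qed
  interpret entourage_sequence "carrier G" E
  proof
    show "E n x x" if "x \<in> carrier G" for n x
      using that \<mu>(2) by (simp add: E_def sym_base_def)
    show "E n y x" if "E n x y" for n x y
      using that inv_quot[of x y] inv_quot[of y x] by (auto simp: E_def sym_base_def)
    show "E n x w" if "E (Suc n) x y" "E (Suc n) y z" "E (Suc n) z w" for n x y z w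
    proof (cases n)
      case (Suc k)
      have c: "x \<in> carrier G" "y \<in> carrier G" "z \<in> carrier G" "w \<in> carrier G"
        using that by (auto simp: E_def)
      have "(inv x \<otimes> y) \<otimes> (inv y \<otimes> z) \<otimes> (inv z \<otimes> w) \<in> B (\<mu> k)"
        using that Suc by (intro \<mu>(3)) (auto simp: E_def)
      also have "(inv x \<otimes> y) \<otimes> (inv y \<otimes> z) \<otimes> (inv z \<otimes> w) = inv x \<otimes> w"
      proof -
        have cancel: "u \<otimes> (inv u \<otimes> v) = v" if "u \<in> carrier G" "v \<in> carrier G" for u v
          using that by (simp add: m_assoc[symmetric])
        show ?thesis using c by (simp add: m_assoc cancel)
      qed
      finally show ?thesis using c Suc by (simp add: E_def sym_base_def)
    qed (use that in \<open>auto simp: E_def\<close>)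
    show "x = y" if xy: "x \<in> carrier G" "y \<in> carrier G" and E: "\<And>n. E n x y" for x y
    proof (rule ccontr)
      assume "x \<noteq> y"
      then obtain U V where "openin X U" "openin X V" "x \<in> U" "y \<in> V" "disjnt U V"
        using hausdorff xy topspace_eq unfolding Hausdorff_space_def by metis
      with nbhd[of U x] E show False by (auto simp: disjnt_iff)
    qed
  qed (auto simp: E_def)
  have top: "mtopology = X"
  proof (rule topology_eq[THEN iffD2], intro allI)
    fix U
    show "openin mtopology U \<longleftrightarrow> openin X U"
    proof
      assume U: "openin mtopology U"
      show "openin X U"
        unfolding openin_subopen[of X U]
      proof
        fix x assume "x \<in> U"
        with U obtain n where n: "\<And>y. E n x y \<Longrightarrow> y \<in> U" and x: "x \<in> carrier G"
          unfolding openin_mtopology_iff_E by blast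
        \<comment> \<open>A rectangle around \<open>(x, x)\<close>: all points of its second side
          are related to \<open>x\<close>, so \<open>B j\<close> lies in \<open>U\<close>.\<close>
        obtain i j where "S n i j" "x \<in> B i" "x \<in> B j"
          using E_refl[OF x, of n] unfolding E_iff by blast
        then show "\<exists>T. openin X T \<and> x \<in> T \<and> T \<subseteq> U"
          using n base_open[of j] unfolding E_iff by blast
      qed
    next
      assume U: "openin X U"
      then have "U \<subseteq> carrier G" using openin_subset topspace_eq by metis
      then show "openin mtopology U"
        unfolding openin_mtopology_iff_E using nbhd[OF U] by simp
    qed
  qed
  have inv: "dist_chain (g \<otimes> x) (g \<otimes> y) = dist_chain x y"
    if "g \<in> carrier G" "x \<in> carrier G" "y \<in> carrier G" for g x y
  proof -
    have E_left: "E n (h \<otimes> x) (h \<otimes> y)" if "h \<in> carrier G" "E n x y" for h n x y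
    proof -
      have "inv (h \<otimes> x) \<otimes> (h \<otimes> y) = inv x \<otimes> y"
        if "x \<in> carrier G" "y \<in> carrier G"
      proof -
        have "inv h \<otimes> (h \<otimes> y) = y"
          using that \<open>h \<in> carrier G\<close> by (simp add: m_assoc[symmetric])
        then show ?thesis
          using that \<open>h \<in> carrier G\<close> by (simp add: inv_mult_group m_assoc)
      qed
      with that show ?thesis by (auto simp: E_def)
    qed
    show ?thesis
      by (rule dist_chain_invariant[where h = "\<lambda>x. inv g \<otimes> x"])
        (use that E_left in \<open>auto simp: m_assoc[symmetric]\<close>)
  qed
  \<comment> \<open>The relation mentions no points, so a single c.e. set of axioms serves all pairs
    \<open>y\<close>, \<open>z\<close>.\<close>
  have "semidecidable (\<lambda>z. chain_code B S (cfst z) (cfst (csnd z)) (cfst (csnd (csnd z))) (csnd (csnd (csnd z))))"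
    by (intro semidecidable_chain_code semi_S semidecidable_base_meet computable_intros)
  from right_cut_operator[OF this] obtain \<Phi> where \<Phi>: "enumeration_operator \<Phi>"
    "\<And>p q \<delta>. 0 \<le> \<delta> \<Longrightarrow>
      (\<And>k l. 0 < l \<Longrightarrow> \<delta> < real k / real l \<longleftrightarrow> (\<exists>a b. a \<in> ran p \<and> b \<in> ran q \<and> chain_code B S k l a b)) \<Longrightarrow>
      nat_to_rat_surj ` \<Phi> (ran (enum_join p q)) = {r. \<delta> < of_rat r}"
    by metis
  have "nat_to_rat_surj ` \<Phi> (ran (enum_join p q)) = {r. dist_chain y z < of_rat r}"
    if "y \<in> carrier G" "z \<in> carrier G" "ran p = point_name B y" "ran q = point_name B z" for y z p q
  proof (rule \<Phi>(2))
    show "dist_chain y z < real k / real l \<longleftrightarrow>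
        (\<exists>a b. a \<in> ran p \<and> b \<in> ran q \<and> chain_code B S k l a b)" if "0 < l" for k l
      unfolding \<open>ran p = _\<close> \<open>ran q = _\<close> point_name_def mem_Collect_eq
      by (rule dist_chain_less_iff_code[OF E_iff]) fact+
  qed (rule nonneg)
  with \<Phi>(1) top inv Metric_space_axioms show ?thesis
    by (intro exI[of _ dist_chain] conjI ballI exI[of _ \<Phi>] allI impI)
qed

end
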